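(* Let $\alpha>0$, $B\in\mathbb{R}$, and let $w:\{0,1,2,\dots\}\to(0,\infty)$ satisfy $\frac{1}{w(n)}=n^{\alpha}\left(1+\frac{2B}{n}+O\left(\frac{1}{n^2}\right)\right)$ as $n\to\infty$. Let $*\in\{-,+,0\}$ and let $(\mathfrak{B}_n,\mathfrak{R}_n)_{n\ge 0}=(\mathfrak{B}^*_n,\mathfrak{R}^*_n)_{n\ge0}$ be the generalized Pólya urn process of type $*$ associated with $w$, with $\mathfrak{D}_n=\mathfrak{R}_n-\mathfrak{B}_n$ and $\tau_n^{\mathfrak{B}}$ the number of draws until the $n$-th blue ball is drawn. Then there exist $M_0,c_4\in(0,\infty)$ such that for every integer $M\ge M_0$, every $n\in\mathbb{N}=\{1,2,\dots\}$ and every real $y\in[0,\sqrt{n}]$, $$\mathbb{P}\left(\sup_{\tau^{\mathfrak{B}}_{Mn}\le i\le\tau^{\mathfrak{B}}_{(M+1)n}}\left|\mathfrak{D}_i-\mathfrak{D}_{\tau^{\mathfrak{B}}_{Mn}}\right|\ge y\sqrt{n}\right)\le\frac{1}{c_4}\,e^{-c_4y^2}.$$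
   Context: No monotonicity of $w$ is assumed. Given sequences of positive numbers $\{b(i)\}_{i\ge0}$ and $\{r(i)\}_{i\ge0}$, the generalized Pólya urn process $\{(\mathfrak{B}_n,\mathfrak{R}_n)\}_{n\ge0}$ is the Markov chain on $\{0,1,2,\dots\}^2$ started at $(0,0)$ which from state $(i,j)$ moves to $(i+1,j)$ with probability $\frac{b(i)}{b(i)+r(j)}$ and to $(i,j+1)$ with probability $\frac{r(j)}{b(i)+r(j)}$. Here $\mathfrak{B}_n$ and $\mathfrak{R}_n$ are the numbers of blue and red balls drawn in the first $n$ draws. For $*\in\{-,+,0\}$, the urn process of type $*$ associated with $w$, denoted $(\mathfrak{B}^*_n,\mathfrak{R}^*_n)_{n\ge0}$, is the one with $b=b^*$, $r=r^*$, where for $i\ge0$: $b^-(i)=w(2i)$, $r^-(i)=w(2i+1)$; $b^+(i)=w(2i+1)$, $r^+(i)=w(2i)$; $b^0(i)=r^0(i)=w(2i)$. The discrepancy is $\mathfrak{D}^*_n=\mathfrak{R}^*_n-\mathfrak{B}^*_n$. The times $\tau_k^{\mathfrak{B}^*}$ are defined by $\tau_0^{\mathfrak{B}^*}=0$ and $\tau_k^{\mathfrak{B}^*}=\inf\{n>\tau_{k-1}^{\mathfrak{B}^*}:\mathfrak{B}^*_n=\mathfrak{B}^*_{n-1}+1\}$ for $k\ge1$. The superscript $*$ is dropped in the claim. *)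

theory Defs
  imports "HOL-Probability.Probability"
begin

definition markov_chain ::
    "'a measure \<Rightarrow> ('s::countable \<Rightarrow> 's pmf) \<Rightarrow> 's \<Rightarrow> (nat \<Rightarrow> 'a \<Rightarrow> 's) \<Rightarrow> bool" where
  "markov_chain \<Omega> K s X \<longleftrightarrow>
     prob_space \<Omega> \<and>
     (\<forall>n. X n \<in> measurable \<Omega> (count_space UNIV)) \<and>
     (AE \<omega> in \<Omega>. X 0 \<omega> = s) \<and>
     (\<forall>n x y. \<P>(\<omega> in \<Omega>. \<forall>k\<le>n. X k \<omega> = x k) > 0 \<longrightarrow>
        \<P>(\<omega> in \<Omega>. X (Suc n) \<omega> = y \<bar> \<forall>k\<le>n. X k \<omega> = x k) = pmf (K (x n)) y)"

definition urn_kernel :: "(nat \<Rightarrow> real) \<Rightarrow> (nat \<Rightarrow> real) \<Rightarrow> nat \<times> nat \<Rightarrow> (nat \<times> nat) pmf" where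
  "urn_kernel b r = (\<lambda>(i, j).
     map_pmf (\<lambda>blue. if blue then (i + 1, j) else (i, j + 1)) (bernoulli_pmf (b i / (b i + r j))))"

definition polya_urn ::
    "'a measure \<Rightarrow> (nat \<Rightarrow> real) \<Rightarrow> (nat \<Rightarrow> real) \<Rightarrow> (nat \<Rightarrow> 'a \<Rightarrow> nat) \<Rightarrow> (nat \<Rightarrow> 'a \<Rightarrow> nat) \<Rightarrow> bool" where
  "polya_urn \<Omega> b r Bl Rd \<longleftrightarrow>
     markov_chain \<Omega> (urn_kernel b r) (0, 0) (\<lambda>n \<omega>. (Bl n \<omega>, Rd n \<omega>))"

datatype urn_type = Minus_Type | Plus_Type | Zero_Type

fun blue_weight :: "urn_type \<Rightarrow> (nat \<Rightarrow> real) \<Rightarrow> nat \<Rightarrow> real" where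
  "blue_weight Minus_Type w i = w (2 * i)"
| "blue_weight Plus_Type w i = w (2 * i + 1)"
| "blue_weight Zero_Type w i = w (2 * i)"

fun red_weight :: "urn_type \<Rightarrow> (nat \<Rightarrow> real) \<Rightarrow> nat \<Rightarrow> real" where
  "red_weight Minus_Type w i = w (2 * i + 1)"
| "red_weight Plus_Type w i = w (2 * i)"
| "red_weight Zero_Type w i = w (2 * i)"

definition discrepancy :: "(nat \<Rightarrow> 'a \<Rightarrow> nat) \<Rightarrow> (nat \<Rightarrow> 'a \<Rightarrow> nat) \<Rightarrow> nat \<Rightarrow> 'a \<Rightarrow> int" where
  "discrepancy Bl Rd n \<omega> = int (Rd n \<omega>) - int (Bl n \<omega>)"

text \<open>The times live in \<^typ>\<open>enat\<close>, so that the infimum is infinite on the (null) event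
  that fewer than \<open>k\<close> blue balls are ever drawn. The strict inequality forces \<open>n \<ge> 1\<close>,
  so \<open>n - 1\<close> is never truncated.\<close>

primrec blue_time :: "(nat \<Rightarrow> 'a \<Rightarrow> nat) \<Rightarrow> nat \<Rightarrow> 'a \<Rightarrow> enat" where
  "blue_time Bl 0 \<omega> = 0"
| "blue_time Bl (Suc k) \<omega> =
     Inf {enat n | n. blue_time Bl k \<omega> < enat n \<and> Bl n \<omega> = Bl (n - 1) \<omega> + 1}"

text \<open>The supremum is taken in \<^typ>\<open>ereal\<close>, so it exists also on the null event where the
  end time is infinite. If the start time is infinite, the index set is empty and the (then
  meaningless) value of \<open>the_enat\<close> is not used.\<close>

definition max_deviation ::
    "(nat \<Rightarrow> 'a \<Rightarrow> nat) \<Rightarrow> (nat \<Rightarrow> 'a \<Rightarrow> nat) \<Rightarrow> nat \<Rightarrow> nat \<Rightarrow> 'a \<Rightarrow> ereal" where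
  "max_deviation Bl Rd k l \<omega> =
     (SUP i\<in>{i. blue_time Bl k \<omega> \<le> enat i \<and> enat i \<le> blue_time Bl l \<omega>}.
        ereal \<bar>real_of_int (discrepancy Bl Rd i \<omega> - discrepancy Bl Rd (the_enat (blue_time Bl k \<omega>)) \<omega>)\<bar>)"

end

theory Submission
  imports Defs "HOL-Real_Asymp.Real_Asymp"
begin

text \<open>
  Put \<open>A(i) = (\<Sum>l<i. 1 / b l)\<close> and \<open>R(j) = (\<Sum>l<j. 1 / r l)\<close>. Since blue is drawn with probability
  \<open>b i / (b i + r j)\<close>, the process \<open>A(i) - R(j)\<close>, evaluated at the numbers \<open>(i, j)\<close> of balls drawn, is a martingale.
  The inverse weights of both colours are \<open>a * i powr \<alpha> + O(i powr (\<alpha> - 1))\<close> with the same \<open>a\<close>. So while both counts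
  are of order \<open>k\<close>, the martingale is essentially \<open>- a * k powr \<alpha>\<close> times the discrepancy, its steps are
  \<open>O(k powr \<alpha>)\<close>, and Azuma's inequality turns a large discrepancy into a Gaussian bound. No drift of the
  discrepancy itself has to be analysed.
  
  Let \<open>k = M * n\<close> and \<open>h = y * sqrt n\<close>. The argument has two stages. First, when the \<open>k\<close>-th blue ball is drawn, the
  number of red balls is within \<open>m = \<delta> * M * h\<close> of \<open>k\<close>, except with probability \<open>exp (- const * m\<^sup>2 / k)\<close>, which is
  at most \<open>exp (- const * y\<^sup>2)\<close> (lemma \<open>early_imbalance_rare\<close>). Second, from such a state the discrepancy can move
  by \<open>h\<close> within \<open>n\<close> blue draws only if the martingale moves by order \<open>h * k powr \<alpha>\<close>: the inverse weights of the two
  colours differ by \<open>O((m + 1) * k powr (\<alpha> - 1))\<close>, which over \<open>n\<close> draws adds up to \<open>O((\<delta> * h + 1) * k powr \<alpha>)\<close>, and this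
  is a small part of \<open>h * k powr \<alpha>\<close> for small \<open>\<delta>\<close> and \<open>y\<close> bounded below. As this takes at most \<open>3 * n\<close> steps, the
  probability is at most \<open>exp (- const * h\<^sup>2 / n) = exp (- const * y\<^sup>2)\<close> (lemma \<open>deviation_after_entry_rare\<close>). For
  small \<open>y\<close> the claim is trivial, and \<open>M0 = 1\<close> suffices.
  
  Both stages ask for the probability of reaching a set \<open>E\<close> through a set \<open>D\<close> in boundedly many steps. For this
  Azuma's inequality follows by induction on the number of steps (lemmas \<open>reach_from_cyl\<close> and \<open>azuma_reach\<close>).
\<close>

section \<open>Hitting probabilities of Markov chains\<close>

definition reaches :: "'s set \<Rightarrow> 's set \<Rightarrow> nat \<Rightarrow> (nat \<Rightarrow> 's) \<Rightarrow> bool" where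
  "reaches D E T x \<longleftrightarrow> (\<exists>i\<le>T. x i \<in> E \<and> (\<forall>l<i. x l \<in> D))"

lemma reaches_0: "reaches D E 0 x \<longleftrightarrow> x 0 \<in> E"
  by (simp add: reaches_def)

lemma reaches_Suc:
  "reaches D E (Suc T) x \<longleftrightarrow> x 0 \<in> E \<or> (x 0 \<in> D \<and> reaches D E T (\<lambda>i. x (Suc i)))"
proof
  assume "reaches D E (Suc T) x"
  then obtain i where i: "i \<le> Suc T" "x i \<in> E" "\<forall>l<i. x l \<in> D"
    by (auto simp: reaches_def)
  show "x 0 \<in> E \<or> (x 0 \<in> D \<and> reaches D E T (\<lambda>i. x (Suc i)))"
    using i by (cases i) (auto simp: reaches_def)
next
  assume *: "x 0 \<in> E \<or> (x 0 \<in> D \<and> reaches D E T (\<lambda>i. x (Suc i)))"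
  show "reaches D E (Suc T) x"
  proof (cases "x 0 \<in> E")
    case True
    then show ?thesis by (auto simp: reaches_def)
  next
    case False
    with * obtain i where i: "x 0 \<in> D" "i \<le> T" "x (Suc i) \<in> E" "\<forall>l<i. x (Suc l) \<in> D"
      by (auto simp: reaches_def)
    have "\<forall>l<Suc i. x l \<in> D"
      using i by (auto simp: less_Suc_eq_0_disj)
    with i show ?thesis
      unfolding reaches_def by (intro exI[of _ "Suc i"]) auto
  qed
qed


text \<open>
  A bound on the time spent in \<open>D\<close> bounds the hitting time: the step into \<open>E\<close> comes right after a
  time spent in \<open>D\<close>. So it is enough to exhibit some visit to \<open>E\<close>, however late.
\<close>

lemma reaches_first:
  assumes "x i \<in> E"
    and "\<And>l. l < i \<Longrightarrow> x l \<notin> E \<Longrightarrow> x l \<in> D \<and> l < T"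
  shows "reaches D E T x"
proof -
  define i' where "i' = (LEAST i. x i \<in> E)"
  have i': "x i' \<in> E" "i' \<le> i" and least: "\<And>l. l < i' \<Longrightarrow> x l \<notin> E"
    unfolding i'_def using assms(1) by (auto intro: LeastI Least_le dest: not_less_Least)
  have before: "x l \<in> D \<and> l < T" if "l < i'" for l
    using assms(2)[of l] least[of l] i'(2) that by simp
  have "i' \<le> T"
    using before[of "i' - 1"] by (cases "i' = 0") auto
  with i'(1) before show ?thesis
    unfolding reaches_def by blast
qed

lemma reaches_Un: "reaches D (E \<union> E') T x \<longleftrightarrow> reaches D E T x \<or> reaches D E' T x"
  by (auto simp: reaches_def)

locale chain = prob_space \<Omega> for \<Omega> :: "'a measure" +
  fixes K :: "'s::countable \<Rightarrow> 's pmf" and s\<^sub>0 :: 's and X :: "nat \<Rightarrow> 'a \<Rightarrow> 's"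
  assumes markov: "markov_chain \<Omega> K s\<^sub>0 X"
begin

lemma X_measurable [measurable]: "X n \<in> measurable \<Omega> (count_space UNIV)"
  using markov by (simp add: markov_chain_def)

lemma AE_start: "AE \<omega> in \<Omega>. X 0 \<omega> = s\<^sub>0"
  using markov by (simp add: markov_chain_def)

definition cyl :: "(nat \<Rightarrow> 's) \<Rightarrow> nat \<Rightarrow> 'a set" where
  "cyl x n = {\<omega>\<in>space \<Omega>. \<forall>k\<le>n. X k \<omega> = x k}"

lemma cyl_measurable [measurable]: "cyl x n \<in> sets \<Omega>"
  unfolding cyl_def by measurable

lemma reaches_measurable [measurable]:
  "Measurable.pred \<Omega> (\<lambda>\<omega>. reaches D E T (\<lambda>i. X (n + i) \<omega>))"
  unfolding reaches_def by measurable

lemma emeasure_cyl_step: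
  "emeasure \<Omega> {\<omega>\<in>cyl x n. X (Suc n) \<omega> = y} = emeasure \<Omega> (cyl x n) * ennreal (pmf (K (x n)) y)"
proof (cases "prob (cyl x n) > 0")
  case True
  have eq: "{\<omega>\<in>space \<Omega>. X (Suc n) \<omega> = y \<and> (\<forall>k\<le>n. X k \<omega> = x k)} = {\<omega>\<in>cyl x n. X (Suc n) \<omega> = y}"
    by (auto simp: cyl_def)
  have "\<P>(\<omega> in \<Omega>. X (Suc n) \<omega> = y \<bar> \<forall>k\<le>n. X k \<omega> = x k) = pmf (K (x n)) y"
    using True markov by (simp add: markov_chain_def cyl_def)
  then have "prob {\<omega>\<in>cyl x n. X (Suc n) \<omega> = y} = pmf (K (x n)) y * prob (cyl x n)"
    unfolding cond_prob_def eq using True by (simp add: cyl_def field_simps)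
  then show ?thesis
    by (simp add: emeasure_eq_measure ennreal_mult[symmetric] mult.commute)
next
  case False
  then have "emeasure \<Omega> (cyl x n) = 0"
    by (simp add: emeasure_eq_measure measure_nonneg order.antisym not_less)
  moreover have "emeasure \<Omega> {\<omega>\<in>cyl x n. X (Suc n) \<omega> = y} \<le> emeasure \<Omega> (cyl x n)"
    by (rule emeasure_mono) auto
  ultimately show ?thesis by simp
qed

text \<open>
  The exponential supermartingale argument without filtrations or stopping times: if \<open>h\<close> grows in mean
  by a factor at most \<open>q\<close> per step while the chain is in \<open>D\<close>, and \<open>h \<ge> 1\<close> on \<open>E\<close>, then \<open>q ^ T * h s\<close> bounds
  the probability of reaching \<open>E\<close> from \<open>s\<close> through \<open>D\<close> within \<open>T\<close> steps. Conditioning on whole initial paths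
  makes the induction on \<open>T\<close> a direct use of the defining property of the chain.
\<close>

lemma reach_from_cyl:
  fixes h :: "'s \<Rightarrow> ennreal" and q :: ennreal
  assumes super: "\<And>s. s \<in> D \<Longrightarrow> (\<integral>\<^sup>+y. h y \<partial>measure_pmf (K s)) \<le> q * h s"
    and target: "\<And>s. s \<in> E \<Longrightarrow> 1 \<le> h s" and q: "1 \<le> q"
  shows "emeasure \<Omega> {\<omega>\<in>cyl x n. reaches D E T (\<lambda>i. X (n + i) \<omega>)}
           \<le> emeasure \<Omega> (cyl x n) * (q ^ T * h (x n))"
proof -
  have in_E: "emeasure \<Omega> {\<omega>\<in>cyl x n. reaches D E T (\<lambda>i. X (n + i) \<omega>)}
           \<le> emeasure \<Omega> (cyl x n) * (q ^ T * h (x n))" if "x n \<in> E" for x n T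
  proof -
    have "1 * 1 \<le> q ^ T * h (x n)"
      using target[OF that] q by (intro mult_mono one_le_power) auto
    then have "emeasure \<Omega> (cyl x n) * 1 \<le> emeasure \<Omega> (cyl x n) * (q ^ T * h (x n))"
      by (intro mult_left_mono) auto
    moreover have "emeasure \<Omega> {\<omega>\<in>cyl x n. reaches D E T (\<lambda>i. X (n + i) \<omega>)} \<le> emeasure \<Omega> (cyl x n)"
      by (intro emeasure_mono) auto
    ultimately show ?thesis by simp
  qed
  show ?thesis
  proof (induction T arbitrary: x n)
    case 0
    show ?case
    proof (cases "x n \<in> E")
      case False
      then have "{\<omega>\<in>cyl x n. reaches D E 0 (\<lambda>i. X (n + i) \<omega>)} = {}"
        by (auto simp: reaches_0 cyl_def)
      then show ?thesis by (simp only: emeasure_empty zero_le)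
    qed (rule in_E)
  next
    case (Suc T)
    consider "x n \<in> E" | "x n \<notin> E" "x n \<in> D" | "x n \<notin> E" "x n \<notin> D"
      by blast
    then show ?case
    proof cases
      case 1
      then show ?thesis by (rule in_E)
    next
      case 3
      then have "{\<omega>\<in>cyl x n. reaches D E (Suc T) (\<lambda>i. X (n + i) \<omega>)} = {}"
        by (auto simp: reaches_Suc cyl_def)
      then show ?thesis by (simp only: emeasure_empty zero_le)
    next
      case 2
      define F where "F y = {\<omega>\<in>cyl (x(Suc n := y)) (Suc n). reaches D E T (\<lambda>i. X (Suc n + i) \<omega>)}" for y
      have step: "cyl (x(Suc n := y)) (Suc n) = {\<omega>\<in>cyl x n. X (Suc n) \<omega> = y}" for y
        by (auto simp: cyl_def le_Suc_eq)
      have F_sets: "F y \<in> sets \<Omega>" for y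
        unfolding F_def by measurable
      have "{\<omega>\<in>cyl x n. reaches D E (Suc T) (\<lambda>i. X (n + i) \<omega>)} = (\<Union>y\<in>UNIV. F y)"
        using 2 by (auto simp: F_def step reaches_Suc) (auto simp: cyl_def)
      then have "emeasure \<Omega> {\<omega>\<in>cyl x n. reaches D E (Suc T) (\<lambda>i. X (n + i) \<omega>)}
          = (\<integral>\<^sup>+y. emeasure \<Omega> (F y) \<partial>count_space UNIV)"
        using F_sets
        by (simp only:) (rule emeasure_UN_countable, auto simp: disjoint_family_on_def F_def step)
      also have "\<dots> \<le> (\<integral>\<^sup>+y. emeasure \<Omega> (cyl x n) * q ^ T * (ennreal (pmf (K (x n)) y) * h y) \<partial>count_space UNIV)"
      proof (rule nn_integral_mono)
        fix y
        show "emeasure \<Omega> (F y) \<le> emeasure \<Omega> (cyl x n) * q ^ T * (ennreal (pmf (K (x n)) y) * h y)"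
          using Suc.IH[of "x(Suc n := y)" "Suc n"]
          unfolding F_def[symmetric] unfolding step emeasure_cyl_step by (simp add: mult_ac)
      qed
      also have "\<dots> = emeasure \<Omega> (cyl x n) * q ^ T * (\<integral>\<^sup>+y. h y \<partial>measure_pmf (K (x n)))"
        by (simp add: nn_integral_cmult nn_integral_measure_pmf)
      also have "\<dots> \<le> emeasure \<Omega> (cyl x n) * q ^ T * (q * h (x n))"
        by (intro mult_left_mono super 2) auto
      finally show ?thesis by (simp add: mult_ac)
    qed
  qed
qed

text \<open>
  An event of the past up to time \<open>n\<close> splits into countably many initial paths, so the bound survives
  conditioning on it. This stands in for the strong Markov property below: the time of entry is
  fixed by the event.
\<close>

lemma reach_from_past_event:
  fixes h :: "'s \<Rightarrow> ennreal" and q :: ennreal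
  assumes super: "\<And>s. s \<in> D \<Longrightarrow> (\<integral>\<^sup>+y. h y \<partial>measure_pmf (K s)) \<le> q * h s"
    and target: "\<And>s. s \<in> E \<Longrightarrow> 1 \<le> h s" and q: "1 \<le> q"
    and past: "\<And>x x'. (\<And>k. k \<le> n \<Longrightarrow> x k = x' k) \<Longrightarrow> Q x = Q x'"
    and start: "\<And>x. Q x \<Longrightarrow> h (x n) \<le> c"
  shows "emeasure \<Omega> {\<omega>\<in>space \<Omega>. Q (\<lambda>k. X k \<omega>) \<and> reaches D E T (\<lambda>i. X (n + i) \<omega>)}
           \<le> emeasure \<Omega> {\<omega>\<in>space \<Omega>. Q (\<lambda>k. X k \<omega>)} * (q ^ T * c)"
proof -
  define I where "I = {x \<in> PiE {..n} (\<lambda>_. UNIV). Q x}"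
  have I: "countable I"
    unfolding I_def by (rule countable_subset[of _ "PiE {..n} (\<lambda>_. UNIV)"]) (auto intro!: countable_PiE)
  have decomp: "{\<omega>\<in>space \<Omega>. Q (\<lambda>k. X k \<omega>) \<and> P \<omega>} = (\<Union>x\<in>I. {\<omega>\<in>cyl x n. P \<omega>})" for P
  proof (intro set_eqI iffI)
    fix \<omega> assume \<omega>: "\<omega> \<in> {\<omega>\<in>space \<Omega>. Q (\<lambda>k. X k \<omega>) \<and> P \<omega>}"
    let ?x = "restrict (\<lambda>k. X k \<omega>) {..n}"
    have "Q ?x = Q (\<lambda>k. X k \<omega>)"
      by (rule past) auto
    with \<omega> have "?x \<in> I" "\<omega> \<in> cyl ?x n" "P \<omega>"
      by (auto simp: I_def cyl_def)
    then show "\<omega> \<in> (\<Union>x\<in>I. {\<omega>\<in>cyl x n. P \<omega>})" by blast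
  next
    fix \<omega> assume "\<omega> \<in> (\<Union>x\<in>I. {\<omega>\<in>cyl x n. P \<omega>})"
    then obtain x where x: "Q x" "\<omega> \<in> cyl x n" "P \<omega>"
      by (auto simp: I_def)
    then have "Q x = Q (\<lambda>k. X k \<omega>)"
      by (intro past) (auto simp: cyl_def)
    with x show "\<omega> \<in> {\<omega>\<in>space \<Omega>. Q (\<lambda>k. X k \<omega>) \<and> P \<omega>}"
      by (auto simp: cyl_def)
  qed
  have disj: "disjoint_family_on (\<lambda>x. {\<omega>\<in>cyl x n. P \<omega>}) I" for P
  proof (unfold disjoint_family_on_def, intro ballI impI equals0I)
    fix x x' \<omega> assume x: "x \<in> I" "x' \<in> I" "x \<noteq> x'"
      and "\<omega> \<in> {\<omega>\<in>cyl x n. P \<omega>} \<inter> {\<omega>\<in>cyl x' n. P \<omega>}"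
    then have "x = x'"
      by (intro PiE_ext[of x "{..n}" "\<lambda>_. UNIV"]) (auto simp: I_def cyl_def)
    with x show False by simp
  qed
  have "emeasure \<Omega> {\<omega>\<in>space \<Omega>. Q (\<lambda>k. X k \<omega>) \<and> reaches D E T (\<lambda>i. X (n + i) \<omega>)}
      = (\<integral>\<^sup>+x. emeasure \<Omega> {\<omega>\<in>cyl x n. reaches D E T (\<lambda>i. X (n + i) \<omega>)} \<partial>count_space I)"
    unfolding decomp by (rule emeasure_UN_countable[OF _ I disj]) measurable
  also have "\<dots> \<le> (\<integral>\<^sup>+x. emeasure \<Omega> (cyl x n) * (q ^ T * c) \<partial>count_space I)"
  proof (rule nn_integral_mono)
    fix x assume "x \<in> space (count_space I)"
    then have "h (x n) \<le> c"
      using start by (auto simp: I_def)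
    then have "emeasure \<Omega> (cyl x n) * (q ^ T * h (x n)) \<le> emeasure \<Omega> (cyl x n) * (q ^ T * c)"
      by (intro mult_left_mono) auto
    with reach_from_cyl[OF super target q, of D E x n T]
    show "emeasure \<Omega> {\<omega>\<in>cyl x n. reaches D E T (\<lambda>i. X (n + i) \<omega>)} \<le> emeasure \<Omega> (cyl x n) * (q ^ T * c)"
      by simp
  qed
  also have "\<dots> = (\<integral>\<^sup>+x. emeasure \<Omega> (cyl x n) \<partial>count_space I) * (q ^ T * c)"
    by (rule nn_integral_multc) auto
  also have "(\<integral>\<^sup>+x. emeasure \<Omega> (cyl x n) \<partial>count_space I) = emeasure \<Omega> {\<omega>\<in>space \<Omega>. Q (\<lambda>k. X k \<omega>)}"
    using emeasure_UN_countable[OF _ I disj[of "\<lambda>_. True"]] decomp[of "\<lambda>_. True"] by simp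
  finally show ?thesis .
qed

text \<open>
  Azuma's inequality for hitting probabilities. By Hoeffding's lemma,
  \<open>h = exp (\<theta> * (f - f s - g))\<close> satisfies the growth condition of \<open>reach_from_past_event\<close> with
  \<open>q = exp (\<theta>\<^sup>2 * \<kappa>\<^sup>2 / 2)\<close> as long as \<open>f\<close> is a martingale with steps at most \<open>\<kappa>\<close> on \<open>D\<close>.
\<close>

lemma azuma_reach:
  fixes f :: "'s \<Rightarrow> real"
  assumes step: "\<And>s y. s \<in> D \<Longrightarrow> y \<in> set_pmf (K s) \<Longrightarrow> \<bar>f y - f s\<bar> \<le> \<kappa>"
    and mart: "\<And>s. s \<in> D \<Longrightarrow> measure_pmf.expectation (K s) f = f s"
    and gap: "\<And>y. y \<in> E \<Longrightarrow> f y - f s \<ge> g"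
    and pos: "g > 0" "\<kappa> > 0" "T > 0"
    and past: "\<And>x x'. (\<And>k. k \<le> n \<Longrightarrow> x k = x' k) \<Longrightarrow> Q x = Q x'"
    and start: "\<And>x. Q x \<Longrightarrow> x n = s"
  shows "prob {\<omega>\<in>space \<Omega>. Q (\<lambda>k. X k \<omega>) \<and> reaches D E T (\<lambda>i. X (n + i) \<omega>)}
           \<le> prob {\<omega>\<in>space \<Omega>. Q (\<lambda>k. X k \<omega>)} * exp (- (g\<^sup>2 / (2 * \<kappa>\<^sup>2 * real T)))"
proof -
  \<comment> \<open>This value minimizes the exponent \<open>T * \<theta>\<^sup>2 * \<kappa>\<^sup>2 / 2 - \<theta> * g\<close>.\<close>
  define \<theta> where "\<theta> = g / (\<kappa>\<^sup>2 * real T)"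
  define h where "h y = ennreal (exp (\<theta> * (f y - f s - g)))" for y
  define q where "q = ennreal (exp (\<theta>\<^sup>2 * \<kappa>\<^sup>2 / 2))"
  have \<theta>: "\<theta> > 0" using pos by (simp add: \<theta>_def)
  have super: "(\<integral>\<^sup>+y. h y \<partial>measure_pmf (K u)) \<le> q * h u" if u: "u \<in> D" for u
  proof -
    interpret interval_bounded_random_variable "measure_pmf (K u)" "\<lambda>y. f y - f u" "-\<kappa>" \<kappa>
      by unfold_locales
         (use step[OF u] in \<open>force simp: AE_measure_pmf_iff abs_le_iff\<close>)+
    have int: "integrable (measure_pmf (K u)) f"
    proof -
      have "integrable (measure_pmf (K u)) (\<lambda>y. (f y - f u) + f u)"
        by (intro Bochner_Integration.integrable_add integrable) auto
      then show ?thesis by simp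
    qed
    have E0: "measure_pmf.expectation (K u) (\<lambda>y. f y - f u) = 0"
      using mart[OF u] int by (simp add: Bochner_Integration.integral_diff)
    have "(\<integral>\<^sup>+y. h y \<partial>measure_pmf (K u))
        = (\<integral>\<^sup>+y. h u * ennreal (exp (\<theta> * (f y - f u))) \<partial>measure_pmf (K u))"
      by (intro nn_integral_cong)
         (simp add: h_def ennreal_mult[symmetric] exp_add[symmetric] algebra_simps)
    also have "\<dots> = h u * (\<integral>\<^sup>+y. ennreal (exp (\<theta> * (f y - f u))) \<partial>measure_pmf (K u))"
      by (rule nn_integral_cmult) auto
    also have "\<dots> \<le> h u * ennreal (exp (\<theta>\<^sup>2 * (\<kappa> - - \<kappa>)\<^sup>2 / 8))"
      by (intro mult_left_mono Hoeffdings_lemma_nn_integral_0 \<theta> E0) auto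
    also have "\<theta>\<^sup>2 * (\<kappa> - - \<kappa>)\<^sup>2 / 8 = \<theta>\<^sup>2 * \<kappa>\<^sup>2 / 2"
      by (simp add: power2_eq_square)
    finally show ?thesis by (simp add: q_def mult.commute)
  qed
  have target: "1 \<le> h y" if "y \<in> E" for y
    using gap[OF that] \<theta> by (simp add: h_def)
  have "q ^ T * ennreal (exp (- \<theta> * g)) = ennreal (exp (real T * (\<theta>\<^sup>2 * \<kappa>\<^sup>2 / 2) - \<theta> * g))"
    unfolding q_def
    by (simp add: ennreal_power ennreal_mult[symmetric] exp_of_nat_mult[symmetric] exp_add[symmetric])
  also have "real T * (\<theta>\<^sup>2 * \<kappa>\<^sup>2 / 2) - \<theta> * g = - (g\<^sup>2 / (2 * \<kappa>\<^sup>2 * real T))"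
    using pos by (simp add: \<theta>_def field_simps power2_eq_square)
  finally have rate: "q ^ T * ennreal (exp (- \<theta> * g)) = ennreal (exp (- (g\<^sup>2 / (2 * \<kappa>\<^sup>2 * real T))))" .
  have "emeasure \<Omega> {\<omega>\<in>space \<Omega>. Q (\<lambda>k. X k \<omega>) \<and> reaches D E T (\<lambda>i. X (n + i) \<omega>)}
      \<le> emeasure \<Omega> {\<omega>\<in>space \<Omega>. Q (\<lambda>k. X k \<omega>)} * (q ^ T * ennreal (exp (- \<theta> * g)))"
    by (rule reach_from_past_event[OF super target _ past])
       (auto simp: q_def h_def start)
  then show ?thesis
    unfolding rate by (simp add: emeasure_eq_measure ennreal_mult[symmetric])
qed

end

section \<open>The urn martingale and the times of blue draws\<close>

locale urn = prob_space \<Omega> for \<Omega> :: "'a measure" +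
  fixes b r :: "nat \<Rightarrow> real" and Bl Rd :: "nat \<Rightarrow> 'a \<Rightarrow> nat"
  assumes polya_urn: "polya_urn \<Omega> b r Bl Rd"
    and b_pos: "b i > 0" and r_pos: "r i > 0"

sublocale urn \<subseteq> chain \<Omega> "urn_kernel b r" "(0, 0)" "\<lambda>n \<omega>. (Bl n \<omega>, Rd n \<omega>)"
  by unfold_locales (use polya_urn in \<open>simp add: polya_urn_def\<close>)

context urn
begin

text \<open>
  The martingale that drives the proof. The blue part grows by \<open>1 / b i\<close> with probability proportional
  to \<open>b i\<close>, the red part by \<open>1 / r j\<close> with probability proportional to \<open>r j\<close>, so both have the same drift.
\<close>

definition balance :: "nat \<times> nat \<Rightarrow> real" where
  "balance s = (\<Sum>l<fst s. 1 / b l) - (\<Sum>l<snd s. 1 / r l)"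

lemma prob_blue: "0 < b i / (b i + r j)" "b i / (b i + r j) < 1"
  using b_pos[of i] r_pos[of j] by (auto simp: field_simps)

lemma set_urn_kernel: "set_pmf (urn_kernel b r (i, j)) = {(Suc i, j), (i, Suc j)}"
  using prob_blue[of i j] by (auto simp: urn_kernel_def UNIV_bool)

lemma balance_martingale: "measure_pmf.expectation (urn_kernel b r s) balance = balance s"
proof -
  obtain i j where s: "s = (i, j)" by (cases s)
  have "b i / (b i + r j) * (1 / b i) = (1 - b i / (b i + r j)) * (1 / r j)"
    using b_pos[of i] r_pos[of j] by (simp add: field_simps)
  moreover have "measure_pmf.expectation (urn_kernel b r (i, j)) balance =
     balance (i, j) + b i / (b i + r j) * (1 / b i) - (1 - b i / (b i + r j)) * (1 / r j)"
    using prob_blue[of i j]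
    unfolding urn_kernel_def by (simp add: balance_def algebra_simps)
  ultimately show ?thesis by (simp add: s)
qed

lemma balance_step:
  assumes "y \<in> set_pmf (urn_kernel b r (i, j))"
    and "1 / b i \<le> \<kappa>" "1 / r j \<le> \<kappa>"
  shows "\<bar>balance y - balance (i, j)\<bar> \<le> \<kappa>"
  using assms b_pos[of i] r_pos[of j] by (auto simp: set_urn_kernel balance_def)

definition legal :: "'a \<Rightarrow> bool" where
  "legal \<omega> \<longleftrightarrow> Bl 0 \<omega> = 0 \<and> Rd 0 \<omega> = 0 \<and>
     (\<forall>n. Bl (Suc n) \<omega> = Suc (Bl n \<omega>) \<and> Rd (Suc n) \<omega> = Rd n \<omega> \<or>
          Bl (Suc n) \<omega> = Bl n \<omega> \<and> Rd (Suc n) \<omega> = Suc (Rd n \<omega>))"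

lemma AE_legal: "AE \<omega> in \<Omega>. legal \<omega>"
proof -
  let ?X = "\<lambda>n \<omega>. (Bl n \<omega>, Rd n \<omega>)"
  have step: "AE \<omega> in \<Omega>. ?X (Suc n) \<omega> \<in> set_pmf (urn_kernel b r (?X n \<omega>))" for n
  proof -
    \<comment> \<open>A forbidden transition has probability zero after each of the countably many initial paths.\<close>
    have "AE \<omega> in \<Omega>. \<not> (restrict (\<lambda>k. ?X k \<omega>) {..n} = x \<and> ?X (Suc n) \<omega> = y)"
      if xy: "x \<in> PiE {..n} (\<lambda>_. UNIV)" "y \<notin> set_pmf (urn_kernel b r (x n))" for x y
    proof -
      have "emeasure \<Omega> {\<omega>\<in>cyl x n. ?X (Suc n) \<omega> = y} = 0"
        using xy by (simp add: emeasure_cyl_step set_pmf_iff)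
      moreover have "{\<omega>\<in>cyl x n. ?X (Suc n) \<omega> = y} \<in> sets \<Omega>"
        by measurable
      ultimately have "AE \<omega> in \<Omega>. \<omega> \<notin> {\<omega>\<in>cyl x n. ?X (Suc n) \<omega> = y}"
        by (intro AE_not_in null_setsI)
      then show ?thesis
        by (rule AE_mp) (auto intro!: AE_I2 simp: cyl_def)
    qed
    then have "AE \<omega> in \<Omega>. \<forall>p\<in>{(x, y). x \<in> PiE {..n} (\<lambda>_. UNIV) \<and> y \<notin> set_pmf (urn_kernel b r (x n))}.
        \<not> (restrict (\<lambda>k. ?X k \<omega>) {..n} = fst p \<and> ?X (Suc n) \<omega> = snd p)"
      by (intro AE_ball_countable')
         (auto intro!: countable_subset[of _ "PiE {..n} (\<lambda>_. UNIV) \<times> UNIV"] countable_SIGMA countable_PiE)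
    then show ?thesis
      by (rule AE_mp) (auto intro!: AE_I2)
  qed
  then have "AE \<omega> in \<Omega>. \<forall>n. ?X (Suc n) \<omega> \<in> set_pmf (urn_kernel b r (?X n \<omega>))"
    by (simp add: AE_all_countable)
  with AE_start show ?thesis
    by eventually_elim (auto simp: legal_def set_urn_kernel)
qed

context
  fixes \<omega> assumes legal: "legal \<omega>"
begin

lemma Bl_plus_Rd: "Bl n \<omega> + Rd n \<omega> = n"
proof (induction n)
  case (Suc n)
  then show ?case using legal unfolding legal_def by (metis add_Suc add_Suc_right)
qed (use legal in \<open>simp add: legal_def\<close>)

lemma Bl_Suc_le: "Bl n \<omega> \<le> Bl (Suc n) \<omega>" "Bl (Suc n) \<omega> \<le> Suc (Bl n \<omega>)"
  using legal unfolding legal_def by (metis le_SucI order_refl)+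

lemma Rd_Suc_le: "Rd n \<omega> \<le> Rd (Suc n) \<omega>" "Rd (Suc n) \<omega> \<le> Suc (Rd n \<omega>)"
  using legal unfolding legal_def by (metis le_SucI order_refl)+

lemma Bl_mono: "m \<le> n \<Longrightarrow> Bl m \<omega> \<le> Bl n \<omega>"
  by (rule lift_Suc_mono_le[of "\<lambda>n. Bl n \<omega>"]) (rule Bl_Suc_le)

lemma Rd_mono: "m \<le> n \<Longrightarrow> Rd m \<omega> \<le> Rd n \<omega>"
  by (rule lift_Suc_mono_le[of "\<lambda>n. Rd n \<omega>"]) (rule Rd_Suc_le)

text \<open>
  The blue times are defined through the draws of blue balls; on a legal path they are the hitting
  times of the levels of \<open>Bl\<close>, the only property of them that is needed later.
\<close>

lemma blue_time_le_iff: "blue_time Bl k \<omega> \<le> enat n \<longleftrightarrow> k \<le> Bl n \<omega>"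
proof (induction k arbitrary: n)
  case 0
  show ?case by (simp add: zero_enat_def[symmetric])
next
  case (Suc k)
  let ?S = "{enat m | m. blue_time Bl k \<omega> < enat m \<and> Bl m \<omega> = Bl (m - 1) \<omega> + 1}"
  have "blue_time Bl (Suc k) \<omega> \<le> enat n \<longleftrightarrow> (\<exists>s\<in>?S. s \<le> enat n)"
  proof
    assume "blue_time Bl (Suc k) \<omega> \<le> enat n"
    then have "Inf ?S < enat (Suc n)"
      by (simp only: blue_time.simps) (simp add: le_less_trans[where y = "enat n"])
    then obtain s where "s \<in> ?S" "s < enat (Suc n)"
      unfolding Inf_less_iff by blast
    then show "\<exists>s\<in>?S. s \<le> enat n" by (intro bexI[of _ s]) auto
  next
    assume "\<exists>s\<in>?S. s \<le> enat n"
    then show "blue_time Bl (Suc k) \<omega> \<le> enat n"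
      unfolding blue_time.simps by (blast intro: Inf_lower order_trans)
  qed
  also have "\<dots> \<longleftrightarrow> Suc k \<le> Bl n \<omega>"
  proof
    assume "\<exists>s\<in>?S. s \<le> enat n"
    then obtain m where m: "blue_time Bl k \<omega> < enat m" "Bl m \<omega> = Bl (m - 1) \<omega> + 1" "m \<le> n"
      by auto
    then obtain m' where m': "m = Suc m'"
      by (cases m) (auto simp: zero_enat_def[symmetric])
    have "blue_time Bl k \<omega> \<le> enat m'"
      using m(1) unfolding m' by (cases "blue_time Bl k \<omega>") auto
    then have "k \<le> Bl m' \<omega>" by (simp add: Suc.IH)
    then have "Suc k \<le> Bl m \<omega>" using m(2) m' by simp
    also have "\<dots> \<le> Bl n \<omega>" by (rule Bl_mono) fact
    finally show "Suc k \<le> Bl n \<omega>" .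
  next
    assume n: "Suc k \<le> Bl n \<omega>"
    define m where "m = (LEAST m. Suc k \<le> Bl m \<omega>)"
    have m: "Suc k \<le> Bl m \<omega>" "m \<le> n" and least: "\<And>l. l < m \<Longrightarrow> Bl l \<omega> \<le> k"
      unfolding m_def using n by (auto intro: LeastI Least_le dest: not_less_Least)
    obtain m' where m': "m = Suc m'"
      using m(1) legal by (cases m) (auto simp: legal_def)
    have "Bl m' \<omega> = k" and eq: "Bl m \<omega> = Bl m' \<omega> + 1"
      using m(1) least[of m'] Bl_Suc_le[of m'] by (auto simp: m')
    then have "blue_time Bl k \<omega> \<le> enat m'" by (simp add: Suc.IH)
    then have "blue_time Bl k \<omega> < enat m"
      unfolding m' by (cases "blue_time Bl k \<omega>") auto
    with m(2) eq m' show "\<exists>s\<in>?S. s \<le> enat n"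
      by (intro bexI[of _ "enat m"]) auto
  qed
  finally show ?case .
qed

text \<open>
  The deviations are integers, so a supremum that reaches \<open>h\<close> is witnessed by a single time \<open>i\<close>, even
  if the supremum ranges over infinitely many times. If the \<open>k\<close>-th blue ball is never drawn, the supremum
  is that of the empty set, below every real \<open>h\<close>.
\<close>

lemma max_deviation_ge_imp:
  assumes "max_deviation Bl Rd k l \<omega> \<ge> ereal h" 
  obtains t i where "t \<le> i" "Bl t \<omega> = k" "\<And>m. m < t \<Longrightarrow> Bl m \<omega> < k"
    "\<And>m. m < i \<Longrightarrow> Bl m \<omega> < l" "h \<le> \<bar>real_of_int (discrepancy Bl Rd i \<omega> - discrepancy Bl Rd t \<omega>)\<bar>"
proof -
  let ?I = "{i. blue_time Bl k \<omega> \<le> enat i \<and> enat i \<le> blue_time Bl l \<omega>}"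
  define t where "t = the_enat (blue_time Bl k \<omega>)"
  define d where "d i = \<bar>discrepancy Bl Rd i \<omega> - discrepancy Bl Rd t \<omega>\<bar>" for i
  have "\<exists>i\<in>?I. h \<le> real_of_int (d i)"
  proof (rule ccontr)
    assume none: "\<not> (\<exists>i\<in>?I. h \<le> real_of_int (d i))"
    have small: "real_of_int (d i) \<le> real_of_int (\<lceil>h\<rceil> - 1)" if "i \<in> ?I" for i
    proof -
      have "real_of_int (d i) < h"
        using none that by (meson not_le)
      then show ?thesis by (simp only: of_int_le_iff) linarith
    qed
    have "max_deviation Bl Rd k l \<omega> \<le> ereal (real_of_int (\<lceil>h\<rceil> - 1))"
      unfolding max_deviation_def t_def[symmetric]
    proof (rule SUP_least)
      fix i assume "i \<in> ?I"
      from small[OF this] show "ereal \<bar>real_of_int (discrepancy Bl Rd i \<omega> - discrepancy Bl Rd t \<omega>)\<bar>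
          \<le> ereal (real_of_int (\<lceil>h\<rceil> - 1))"
        by (simp add: d_def)
    qed
    also have "\<dots> < ereal h"
      by simp linarith
    finally show False using assms by simp
  qed
  then obtain i where i: "blue_time Bl k \<omega> \<le> enat i" "enat i \<le> blue_time Bl l \<omega>" "h \<le> real_of_int (d i)"
    by auto
  then have t: "blue_time Bl k \<omega> = enat t"
    by (cases "blue_time Bl k \<omega>") (auto simp: t_def)
  have below: "Bl m \<omega> < k" if "m < t" for m
    using blue_time_le_iff[of k m] t that by auto
  have ge: "k \<le> Bl t \<omega>"
    using blue_time_le_iff[of k t] t by auto
  have "Bl t \<omega> = k"
  proof (cases t)
    case 0
    then show ?thesis using ge legal by (simp add: legal_def)
  next
    case (Suc t')
    then show ?thesis using ge below[of t'] Bl_Suc_le[of t'] by simp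
  qed
  moreover have "Bl m \<omega> < l" if "m < i" for m
  proof -
    have "enat m < blue_time Bl l \<omega>"
      using that i(2) by (meson enat_ord_simps(2) less_le_trans)
    then show ?thesis using blue_time_le_iff[of l m] by auto
  qed
  ultimately show thesis
    using that[of t i] i below t by (simp add: d_def)
qed

end

end

section \<open>Asymptotics of the inverse weights\<close>

lemma powr_window:
  fixes x k e :: real
  assumes "k > 0" "k / 5 \<le> x" "x \<le> 5 * k"
  shows "x powr e \<le> 5 powr \<bar>e\<bar> * k powr e"
proof -
  have x: "x > 0" using assms by linarith
  have "\<bar>ln (x / k)\<bar> \<le> ln 5"
  proof -
    have "ln (x / k) \<le> ln 5" using assms x by (subst ln_le_cancel_iff) (auto simp: field_simps)
    moreover have "ln (1 / 5) \<le> ln (x / k)"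
      using assms x by (subst ln_le_cancel_iff) (auto simp: field_simps)
    ultimately show ?thesis by (simp add: ln_div)
  qed
  then have "e * ln (x / k) \<le> \<bar>e\<bar> * ln 5"
    by (metis abs_ge_self abs_ge_zero abs_mult mult_left_mono order_trans)
  then have "(x / k) powr e \<le> 5 powr \<bar>e\<bar>"
    using assms x by (simp add: powr_def)
  moreover have "x powr e = (x / k) powr e * k powr e"
    using assms x by (simp add: powr_divide)
  ultimately show ?thesis by (simp add: mult_right_mono)
qed

lemma powr_mean_value:
  fixes x y \<alpha> :: real
  assumes "0 < x" "x < y"
  obtains z where "x < z" "z < y" "y powr \<alpha> - x powr \<alpha> = (y - x) * (\<alpha> * z powr (\<alpha> - 1))"
proof -
  have "\<exists>z>x. z < y \<and> y powr \<alpha> - x powr \<alpha> = (y - x) * (\<alpha> * z powr (\<alpha> - 1))"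
    using assms by (intro MVT2 has_real_derivative_powr) auto
  then show thesis using that by blast
qed

lemma powr_diff_window:
  fixes x y k \<alpha> :: real
  assumes "k > 0" "\<alpha> > 0" "k / 5 \<le> x" "x \<le> 5 * k" "k / 5 \<le> y" "y \<le> 5 * k"
  shows "\<bar>x powr \<alpha> - y powr \<alpha>\<bar> \<le> \<alpha> * 5 powr \<bar>\<alpha> - 1\<bar> * k powr (\<alpha> - 1) * \<bar>x - y\<bar>"
proof -
  have *: "y powr \<alpha> - x powr \<alpha> \<le> \<alpha> * 5 powr \<bar>\<alpha> - 1\<bar> * k powr (\<alpha> - 1) * (y - x) \<and> x powr \<alpha> \<le> y powr \<alpha>"
    if "k / 5 \<le> x" "y \<le> 5 * k" "x < y" for x y
  proof -
    have "x > 0" using that assms by linarith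
    then obtain z where z: "x < z" "z < y" "y powr \<alpha> - x powr \<alpha> = (y - x) * (\<alpha> * z powr (\<alpha> - 1))"
      using powr_mean_value[OF \<open>x > 0\<close> \<open>x < y\<close>, of \<alpha>] by blast
    have "\<alpha> * z powr (\<alpha> - 1) \<le> \<alpha> * (5 powr \<bar>\<alpha> - 1\<bar> * k powr (\<alpha> - 1))"
      using z that assms by (intro mult_left_mono powr_window) auto
    then have "(y - x) * (\<alpha> * z powr (\<alpha> - 1)) \<le> (y - x) * (\<alpha> * (5 powr \<bar>\<alpha> - 1\<bar> * k powr (\<alpha> - 1)))"
      using that by (intro mult_left_mono[of "\<alpha> * z powr (\<alpha> - 1)"]) auto
    moreover have "x powr \<alpha> \<le> y powr \<alpha>"
      using that \<open>x > 0\<close> assms by (intro powr_mono2) auto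
    ultimately show ?thesis using z(3) by (simp add: mult_ac)
  qed
  consider "x < y" | "x = y" | "y < x" by linarith
  then show ?thesis
  proof cases
    case 1
    then show ?thesis using *[of x y] assms by (simp add: abs_if)
  next
    case 3
    then show ?thesis using *[of y x] assms by (simp add: abs_if)
  qed simp
qed

text \<open>
  For \<open>\<alpha> \<ge> 1\<close> the terms are at most \<open>k powr (\<alpha> - 1)\<close>; for \<open>\<alpha> < 1\<close> they are dominated by the telescoping
  differences of \<open>l powr \<alpha> / \<alpha>\<close>, by the mean value theorem.
\<close>

lemma sum_powr_le:
  fixes \<alpha> :: real
  assumes "\<alpha> > 0" "i \<le> k"
  shows "(\<Sum>l<i. (real l + 1) powr (\<alpha> - 1)) \<le> (1 + 1 / \<alpha>) * real k powr \<alpha>"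
proof (cases "\<alpha> \<ge> 1")
  case True
  have "(\<Sum>l<i. (real l + 1) powr (\<alpha> - 1)) \<le> (\<Sum>l<i. real k powr (\<alpha> - 1))"
    using True assms by (intro sum_mono powr_mono2) auto
  also have "\<dots> \<le> real k * real k powr (\<alpha> - 1)"
    using assms by (simp add: mult_right_mono)
  also have "\<dots> = real k powr \<alpha>"
    by (cases "k = 0") (auto simp: powr_diff)
  also have "\<dots> \<le> (1 + 1 / \<alpha>) * real k powr \<alpha>"
    using assms by (simp add: field_simps)
  finally show ?thesis .
next
  case False
  have step: "\<alpha> * (real l + 1) powr (\<alpha> - 1) \<le> (real l + 1) powr \<alpha> - real l powr \<alpha>" for l
  proof (cases "l = 0")
    case l: False
    then obtain z where z: "real l < z" "z < real l + 1"
        "(real l + 1) powr \<alpha> - real l powr \<alpha> = (real l + 1 - real l) * (\<alpha> * z powr (\<alpha> - 1))"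
      using powr_mean_value[of "real l" "real l + 1" \<alpha>] by auto
    have "(real l + 1) powr (\<alpha> - 1) \<le> z powr (\<alpha> - 1)"
      using z l False by (intro powr_mono2') auto
    then show ?thesis using z(3) assms by simp
  qed (use False in simp)
  have "\<alpha> * (\<Sum>l<i. (real l + 1) powr (\<alpha> - 1)) \<le> real i powr \<alpha>"
  proof (induction i)
    case (Suc i)
    then show ?case using step[of i] by (simp add: algebra_simps)
  qed simp
  also have "\<dots> \<le> real k powr \<alpha>"
    using assms by (intro powr_mono2) auto
  finally have "(\<Sum>l<i. (real l + 1) powr (\<alpha> - 1)) \<le> real k powr \<alpha> / \<alpha>"
    using assms by (simp add: field_simps)
  also have "\<dots> \<le> (1 + 1 / \<alpha>) * real k powr \<alpha>"
    by (simp add: algebra_simps)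
  finally show ?thesis .
qed

text \<open>
  The index is shifted by one so that the comparison function is positive at every index,
  including \<open>0\<close>.
\<close>

definition near_power :: "real \<Rightarrow> real \<Rightarrow> real \<Rightarrow> (nat \<Rightarrow> real) \<Rightarrow> bool" where
  "near_power \<alpha> a C q \<longleftrightarrow>
     (\<forall>i. q i > 0 \<and> \<bar>q i - a * (real i + 1) powr \<alpha>\<bar> \<le> C * (real i + 1) powr (\<alpha> - 1))"

text \<open>
  From index \<open>2 * C / a\<close> on, the error is at most half of the main term; the finitely many earlier values
  are positive.
\<close>

lemma near_power_lower:
  assumes "near_power \<alpha> a C q" "a > 0" "C > 0"
  obtains c where "c > 0" "\<And>i. c * (real i + 1) powr \<alpha> \<le> q i"
proof -
  define N where "N = nat \<lceil>2 * C / a\<rceil>"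
  define c where "c = Min (insert (a / 2) ((\<lambda>i. q i / (real i + 1) powr \<alpha>) ` {..<N}))"
  have fin: "finite (insert (a / 2) ((\<lambda>i. q i / (real i + 1) powr \<alpha>) ` {..<N}))"
    by simp
  have "c > 0"
    unfolding c_def using assms by (subst Min_gr_iff) (auto simp: near_power_def)
  moreover have "c * (real i + 1) powr \<alpha> \<le> q i" for i
  proof (cases "i < N")
    case True
    then have "c \<le> q i / (real i + 1) powr \<alpha>"
      unfolding c_def by (intro Min_le) auto
    then show ?thesis by (simp add: field_simps)
  next
    case False
    then have "2 * C / a \<le> real i"
      unfolding N_def by linarith
    then have i: "C \<le> a / 2 * (real i + 1)"
      using assms by (simp add: field_simps)
    have "C * (real i + 1) powr (\<alpha> - 1) \<le> a / 2 * (real i + 1) * (real i + 1) powr (\<alpha> - 1)"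
      using i by (rule mult_right_mono) auto
    also have "\<dots> = a / 2 * (real i + 1) powr \<alpha>"
      using powr_mult_base[of "real i + 1" "\<alpha> - 1"] by simp
    finally have "a / 2 * (real i + 1) powr \<alpha> \<le> q i"
      using assms(1) unfolding near_power_def by (smt (verit) field_sum_of_halves distrib_right)
    moreover have "c \<le> a / 2"
      unfolding c_def by (intro Min_le) auto
    then have "c * (real i + 1) powr \<alpha> \<le> a / 2 * (real i + 1) powr \<alpha>"
      by (intro mult_right_mono) auto
    ultimately show ?thesis by linarith
  qed
  ultimately show thesis by (rule that)
qed

text \<open>
  What the probabilistic part uses about the inverse weights \<open>p = 1 / b\<close> and \<open>q = 1 / r\<close> of the two colours:
  both are of order \<open>k powr \<alpha>\<close> at indices of order \<open>k\<close>, they differ there by only \<open>O(k powr (\<alpha> - 1))\<close> per unit of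
  index distance, and their partial sums up to \<open>k\<close> differ by only \<open>O(k powr \<alpha>)\<close>, the size of a single term.
  The conditions are symmetric in \<open>p\<close> and \<open>q\<close>, so each estimate for a surplus of one colour also serves the
  other colour.
\<close>

locale comparable_weights =
  fixes \<alpha> c C :: real and p q :: "nat \<Rightarrow> real"
  assumes c_pos: "c > 0" and C_pos: "C > 0" and \<alpha>_pos: "\<alpha> > 0"
    and lower: "c * (real i + 1) powr \<alpha> \<le> p i" "c * (real i + 1) powr \<alpha> \<le> q i"
    and upper: "k \<ge> 1 \<Longrightarrow> real i + 1 \<le> 5 * real k \<Longrightarrow> p i \<le> C * real k powr \<alpha>"
      "k \<ge> 1 \<Longrightarrow> real i + 1 \<le> 5 * real k \<Longrightarrow> q i \<le> C * real k powr \<alpha>"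
    and diff: "k \<ge> 1 \<Longrightarrow> real k / 2 \<le> real i \<Longrightarrow> real i + 1 \<le> 5 * real k \<Longrightarrow>
      real k / 2 \<le> real j \<Longrightarrow> real j + 1 \<le> 5 * real k \<Longrightarrow>
      \<bar>p i - q j\<bar> \<le> C * real k powr (\<alpha> - 1) * (\<bar>real i - real j\<bar> + 1)"
    and sum_diff: "i \<le> k \<Longrightarrow> \<bar>(\<Sum>l<i. p l) - (\<Sum>l<i. q l)\<bar> \<le> C * real k powr \<alpha>"

lemma comparable_weights_swap:
  assumes "comparable_weights \<alpha> c C p q"
  shows "comparable_weights \<alpha> c C q p"
proof -
  interpret comparable_weights \<alpha> c C p q by fact
  show ?thesis
  proof
    fix k i j :: nat
    assume "k \<ge> 1" "real k / 2 \<le> real i" "real i + 1 \<le> 5 * real k"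
      "real k / 2 \<le> real j" "real j + 1 \<le> 5 * real k"
    then show "\<bar>q i - p j\<bar> \<le> C * real k powr (\<alpha> - 1) * (\<bar>real i - real j\<bar> + 1)"
      using diff[of k j i] by (simp only: abs_minus_commute)
  next
    fix i k :: nat
    assume "i \<le> k"
    then show "\<bar>(\<Sum>l<i. q l) - (\<Sum>l<i. p l)\<bar> \<le> C * real k powr \<alpha>"
      using sum_diff[of i k] by (simp only: abs_minus_commute)
  qed (fact c_pos C_pos \<alpha>_pos lower upper)+
qed

lemma near_power_comparable:
  assumes p: "near_power \<alpha> a C\<^sub>0 p" and q: "near_power \<alpha> a C\<^sub>0 q" and pos: "a > 0" "C\<^sub>0 > 0" "\<alpha> > 0"
  obtains c C where "comparable_weights \<alpha> c C p q"
proof -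
  obtain c\<^sub>1 where c\<^sub>1: "c\<^sub>1 > 0" "\<And>i. c\<^sub>1 * (real i + 1) powr \<alpha> \<le> p i"
    using near_power_lower[OF p pos(1,2)] by blast
  obtain c\<^sub>2 where c\<^sub>2: "c\<^sub>2 > 0" "\<And>i. c\<^sub>2 * (real i + 1) powr \<alpha> \<le> q i"
    using near_power_lower[OF q pos(1,2)] by blast
  define L where "L = (5::real) powr \<bar>\<alpha> - 1\<bar>"
  define U where "U = (a + C\<^sub>0) * 5 powr \<alpha>"
  define V where "V = a * \<alpha> * L + 2 * C\<^sub>0 * L"
  define W where "W = 2 * C\<^sub>0 * (1 + 1 / \<alpha>)"
  define C where "C = U + V + W"
  have nonneg: "U > 0" "V > 0" "W > 0"
    using pos by (auto simp: U_def V_def W_def L_def intro!: add_pos_pos mult_pos_pos)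
  have p': "\<bar>p i - a * (real i + 1) powr \<alpha>\<bar> \<le> C\<^sub>0 * (real i + 1) powr (\<alpha> - 1)"
   and q': "\<bar>q i - a * (real i + 1) powr \<alpha>\<bar> \<le> C\<^sub>0 * (real i + 1) powr (\<alpha> - 1)" for i
    using p q by (auto simp: near_power_def)
  have up: "u \<le> C * real k powr \<alpha>"
    if "\<bar>u - a * (real i + 1) powr \<alpha>\<bar> \<le> C\<^sub>0 * (real i + 1) powr (\<alpha> - 1)"
      and "real i + 1 \<le> 5 * real k" for u i k
  proof -
    have "(real i + 1) powr (\<alpha> - 1) \<le> (real i + 1) powr \<alpha>"
      by (intro powr_mono) auto
    then have "C\<^sub>0 * (real i + 1) powr (\<alpha> - 1) \<le> C\<^sub>0 * (real i + 1) powr \<alpha>"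
      using pos by (intro mult_left_mono) auto
    then have "u \<le> (a + C\<^sub>0) * (real i + 1) powr \<alpha>"
      using that(1) by (simp add: algebra_simps)
    also have "\<dots> \<le> (a + C\<^sub>0) * (5 * real k) powr \<alpha>"
      using that pos by (intro mult_left_mono powr_mono2) auto
    also have "\<dots> = U * real k powr \<alpha>"
      by (simp add: U_def powr_mult)
    also have "\<dots> \<le> C * real k powr \<alpha>"
      using nonneg by (intro mult_right_mono) (auto simp: C_def)
    finally show ?thesis .
  qed
  show thesis
  proof (rule that[of "min c\<^sub>1 c\<^sub>2" C], unfold_locales)
    show "min c\<^sub>1 c\<^sub>2 > 0" "C > 0" "\<alpha> > 0"
      using c\<^sub>1 c\<^sub>2 nonneg pos by (auto simp: C_def)
    fix i :: nat
    have "min c\<^sub>1 c\<^sub>2 * (real i + 1) powr \<alpha> \<le> c\<^sub>1 * (real i + 1) powr \<alpha>"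
      by (intro mult_right_mono) auto
    then show "min c\<^sub>1 c\<^sub>2 * (real i + 1) powr \<alpha> \<le> p i"
      using c\<^sub>1(2)[of i] by linarith
    have "min c\<^sub>1 c\<^sub>2 * (real i + 1) powr \<alpha> \<le> c\<^sub>2 * (real i + 1) powr \<alpha>"
      by (intro mult_right_mono) auto
    then show "min c\<^sub>1 c\<^sub>2 * (real i + 1) powr \<alpha> \<le> q i"
      using c\<^sub>2(2)[of i] by linarith
  next
    fix k i :: nat
    assume "k \<ge> 1" "real i + 1 \<le> 5 * real k"
    then show "p i \<le> C * real k powr \<alpha>" "q i \<le> C * real k powr \<alpha>"
      using up[OF p'] up[OF q'] by auto
  next
    fix k i j :: nat
    assume *: "k \<ge> 1" "real k / 2 \<le> real i" "real i + 1 \<le> 5 * real k"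
      "real k / 2 \<le> real j" "real j + 1 \<le> 5 * real k"
    let ?K = "real k powr (\<alpha> - 1)" and ?d = "\<bar>real i - real j\<bar>"
    have "\<bar>(real i + 1) powr \<alpha> - (real j + 1) powr \<alpha>\<bar> \<le> \<alpha> * L * ?K * ?d"
      using powr_diff_window[of "real k" \<alpha> "real i + 1" "real j + 1"] * pos by (simp add: L_def)
    then have "a * \<bar>(real i + 1) powr \<alpha> - (real j + 1) powr \<alpha>\<bar> \<le> a * (\<alpha> * L * ?K * ?d)"
      using pos by (intro mult_left_mono) auto
    then have main: "\<bar>a * (real i + 1) powr \<alpha> - a * (real j + 1) powr \<alpha>\<bar> \<le> a * \<alpha> * L * ?K * ?d"
      using pos by (simp add: right_diff_distrib[symmetric] abs_mult mult_ac)
    have "C\<^sub>0 * (real i + 1) powr (\<alpha> - 1) \<le> C\<^sub>0 * (L * ?K)"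
      "C\<^sub>0 * (real j + 1) powr (\<alpha> - 1) \<le> C\<^sub>0 * (L * ?K)"
      unfolding L_def using * pos by (intro mult_left_mono powr_window; simp)+
    with main p'[of i] q'[of j]
    have "\<bar>p i - q j\<bar> \<le> a * \<alpha> * L * ?K * ?d + 2 * C\<^sub>0 * L * ?K"
      by (simp add: mult_ac)
    also have "\<dots> \<le> V * ?K * (?d + 1)"
    proof -
      have "0 \<le> a * \<alpha> * L * ?K + 2 * C\<^sub>0 * L * ?K * ?d"
        using pos by (simp add: L_def)
      then show ?thesis by (simp add: V_def algebra_simps)
    qed
    also have "\<dots> \<le> C * ?K * (?d + 1)"
      using nonneg by (intro mult_right_mono) (auto simp: C_def)
    finally show "\<bar>p i - q j\<bar> \<le> C * ?K * (?d + 1)" .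
  next
    fix i k :: nat assume "i \<le> k"
    have "\<bar>(\<Sum>l<i. p l) - (\<Sum>l<i. q l)\<bar> = \<bar>\<Sum>l<i. p l - q l\<bar>"
      by (simp add: sum_subtractf)
    also have "\<dots> \<le> (\<Sum>l<i. \<bar>p l - q l\<bar>)"
      by (rule sum_abs)
    also have "\<dots> \<le> (\<Sum>l<i. 2 * C\<^sub>0 * (real l + 1) powr (\<alpha> - 1))"
    proof (rule sum_mono)
      fix l show "\<bar>p l - q l\<bar> \<le> 2 * C\<^sub>0 * (real l + 1) powr (\<alpha> - 1)"
        using p'[of l] q'[of l] by linarith
    qed
    also have "\<dots> = 2 * C\<^sub>0 * (\<Sum>l<i. (real l + 1) powr (\<alpha> - 1))"
      by (simp add: sum_distrib_left)
    also have "\<dots> \<le> 2 * C\<^sub>0 * ((1 + 1 / \<alpha>) * real k powr \<alpha>)"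
      using \<open>i \<le> k\<close> pos by (intro mult_left_mono sum_powr_le) auto
    also have "\<dots> = W * real k powr \<alpha>" by (simp add: W_def)
    also have "\<dots> \<le> C * real k powr \<alpha>"
      using nonneg by (intro mult_right_mono) (auto simp: C_def)
    finally show "\<bar>(\<Sum>l<i. p l) - (\<Sum>l<i. q l)\<bar> \<le> C * real k powr \<alpha>" .
  qed
qed

text \<open>
  The term with \<open>B\<close> and the shift from \<open>n\<close> to \<open>n + 1\<close> are of relative order \<open>1 / n\<close>, like the bound. The bound
  is positive everywhere, so the finitely many exceptional indices only enlarge the constant.
\<close>

lemma inverse_weight_expansion:
  fixes w :: "nat \<Rightarrow> real"
  assumes "\<epsilon> \<in> O(\<lambda>n. 1 / real n ^ 2)"
    and "\<forall>\<^sub>F n in sequentially. 1 / w n = real n powr \<alpha> * (1 + 2 * B / real n + \<epsilon> n)"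
  obtains C where "C > 0" "\<And>n. \<bar>1 / w n - (real n + 1) powr \<alpha>\<bar> \<le> C * (real n + 1) powr (\<alpha> - 1)"
proof -
  let ?g = "\<lambda>n. (real n + 1) powr (\<alpha> - 1)"
  have "(\<lambda>n. real n powr \<alpha> * (2 * B / real n)) \<in> O(?g)"
    by real_asymp
  moreover have "(\<lambda>n. real n powr \<alpha> * \<epsilon> n) \<in> O(\<lambda>n. real n powr \<alpha> * (1 / real n ^ 2))"
    using assms(1) by (intro landau_o.big.mult) auto
  then have "(\<lambda>n. real n powr \<alpha> * \<epsilon> n) \<in> O(?g)"
    by (rule landau_o.big_trans) real_asymp
  moreover have "(\<lambda>n. real n powr \<alpha> - (real n + 1) powr \<alpha>) \<in> O(?g)"
    by real_asymp
  ultimately have "(\<lambda>n. real n powr \<alpha> * (2 * B / real n) + real n powr \<alpha> * \<epsilon> n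
      + (real n powr \<alpha> - (real n + 1) powr \<alpha>)) \<in> O(?g)"
    by (rule sum_in_bigo(1)[OF sum_in_bigo(1)])
  also have "?this \<longleftrightarrow> (\<lambda>n. 1 / w n - (real n + 1) powr \<alpha>) \<in> O(?g)"
    using assms(2) by (intro landau_o.big.in_cong) (auto elim!: eventually_mono simp: algebra_simps)
  finally obtain C\<^sub>1 where C\<^sub>1: "\<forall>\<^sub>F n in sequentially. norm (1 / w n - (real n + 1) powr \<alpha>) \<le> C\<^sub>1 * norm (?g n)"
    by (auto elim: landau_o.bigE)
  then obtain N where N: "\<And>n. n \<ge> N \<Longrightarrow> norm (1 / w n - (real n + 1) powr \<alpha>) \<le> C\<^sub>1 * norm (?g n)"
    by (auto simp: eventually_sequentially)
  define C where "C = Max (insert 1 (insert C\<^sub>1 ((\<lambda>n. \<bar>1 / w n - (real n + 1) powr \<alpha>\<bar> / ?g n) ` {..<N})))"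
  have "\<bar>1 / w n - (real n + 1) powr \<alpha>\<bar> \<le> C * ?g n" for n
  proof (cases "n < N")
    case True
    then have "\<bar>1 / w n - (real n + 1) powr \<alpha>\<bar> / ?g n \<le> C"
      unfolding C_def by (intro Max_ge) auto
    then show ?thesis by (simp add: field_simps)
  next
    case False
    have "C\<^sub>1 \<le> C" unfolding C_def by (intro Max_ge) auto
    then have "C\<^sub>1 * ?g n \<le> C * ?g n" by (intro mult_right_mono) auto
    moreover have "\<bar>1 / w n - (real n + 1) powr \<alpha>\<bar> \<le> C\<^sub>1 * ?g n"
      using N[of n] False by simp
    ultimately show ?thesis by linarith
  qed
  moreover have "1 \<le> C" unfolding C_def by (intro Max_ge) auto
  ultimately show thesis by (intro that[of C]) auto
qed

lemma near_power_subsequences: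
  fixes w :: "nat \<Rightarrow> real"
  assumes "\<alpha> > 0" and pos: "\<And>n. w n > 0" and "C > 0"
    and w: "\<And>n. \<bar>1 / w n - (real n + 1) powr \<alpha>\<bar> \<le> C * (real n + 1) powr (\<alpha> - 1)"
  obtains C' where "C' > 0" "near_power \<alpha> (2 powr \<alpha>) C' (\<lambda>i. 1 / w (2 * i))"
    "near_power \<alpha> (2 powr \<alpha>) C' (\<lambda>i. 1 / w (2 * i + 1))"
proof -
  define L where "L = (5::real) powr \<bar>\<alpha> - 1\<bar>"
  define C' where "C' = C * L + \<alpha> * L"
  have C': "\<bar>1 / w m - 2 powr \<alpha> * (real i + 1) powr \<alpha>\<bar> \<le> C' * (real i + 1) powr (\<alpha> - 1)"
    if m: "m = 2 * i \<or> m = 2 * i + 1" for m i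
  proof -
    let ?K = "(real i + 1) powr (\<alpha> - 1)"
    have two: "2 powr \<alpha> * (real i + 1) powr \<alpha> = (2 * (real i + 1)) powr \<alpha>"
      by (simp only: powr_mult)
    have "(real m + 1) powr (\<alpha> - 1) \<le> L * ?K"
      unfolding L_def by (rule powr_window) (use m in auto)
    then have "C * (real m + 1) powr (\<alpha> - 1) \<le> C * (L * ?K)"
      using \<open>C > 0\<close> by (intro mult_left_mono) auto
    moreover have "\<bar>(real m + 1) powr \<alpha> - (2 * (real i + 1)) powr \<alpha>\<bar> \<le> \<alpha> * L * ?K * \<bar>(real m + 1) - 2 * (real i + 1)\<bar>"
      unfolding L_def by (rule powr_diff_window) (use m \<open>\<alpha> > 0\<close> in auto)
    moreover have "\<alpha> * L * ?K * \<bar>(real m + 1) - 2 * (real i + 1)\<bar> \<le> \<alpha> * L * ?K * 1"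
      using m \<open>\<alpha> > 0\<close> by (intro mult_left_mono) (auto simp: L_def)
    ultimately show ?thesis
      using w[of m] unfolding two by (simp add: C'_def algebra_simps)
  qed
  show thesis
  proof (rule that[of C'])
    show "C' > 0" using assms by (auto simp: C'_def L_def intro!: add_pos_pos)
    show "near_power \<alpha> (2 powr \<alpha>) C' (\<lambda>i. 1 / w (2 * i))"
      "near_power \<alpha> (2 powr \<alpha>) C' (\<lambda>i. 1 / w (2 * i + 1))"
      using C' pos by (auto simp: near_power_def)
  qed
qed

context comparable_weights
begin

text \<open>
  Lower bound, in units of \<open>k powr \<alpha>\<close>, for every inverse weight at an index of at least about \<open>k / 2\<close>.
\<close>

definition c' :: real where "c' = c / 2 powr \<alpha>"

lemma c'_pos: "c' > 0"
  using c_pos by (simp add: c'_def)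

lemma p_nonneg: "0 \<le> p i" and q_nonneg: "0 \<le> q i"
proof -
  have "0 \<le> c * (real i + 1) powr \<alpha>" using c_pos by simp
  then show "0 \<le> p i" "0 \<le> q i" using lower[of i] by auto
qed

lemma sum_p_block_ge:
  assumes "real k / 2 \<le> real i + 1" "real i + g \<le> real i'" "0 \<le> g"
  shows "c' * g * real k powr \<alpha> \<le> (\<Sum>l=i..<i'. p l)"
proof -
  have "c' * real k powr \<alpha> \<le> p l" if "i \<le> l" for l
  proof -
    have "c' * real k powr \<alpha> = c * (real k / 2) powr \<alpha>"
      by (simp add: c'_def powr_divide)
    also have "\<dots> \<le> c * (real l + 1) powr \<alpha>"
      using that assms c_pos \<alpha>_pos by (intro mult_left_mono powr_mono2) auto
    finally show ?thesis using lower(1)[of l] by linarith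
  qed
  then have "(\<Sum>l=i..<i'. c' * real k powr \<alpha>) \<le> (\<Sum>l=i..<i'. p l)"
    by (intro sum_mono) auto
  moreover have "(\<Sum>l=i..<i'. c' * real k powr \<alpha>) = real (i' - i) * (c' * real k powr \<alpha>)"
    by simp
  moreover have "g * (c' * real k powr \<alpha>) \<le> real (i' - i) * (c' * real k powr \<alpha>)"
    using assms c'_pos by (intro mult_right_mono) auto
  ultimately show ?thesis by (simp add: mult_ac)
qed

text \<open>
  If the \<open>p\<close>-colour has \<open>g\<close> more balls than level \<open>i\<^sub>0\<close> and the other colour has at most \<open>i\<^sub>0\<close>, then the sums up to
  \<open>i\<^sub>0\<close> nearly cancel and the surplus terms remain. The level \<open>i\<^sub>0\<close> is \<open>k\<close> for a surplus of red balls and about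
  \<open>k - g\<close> for a deficit.
\<close>

lemma gap_from_origin:
  assumes "j \<le> i\<^sub>0" "i\<^sub>0 \<le> k" "real k / 2 \<le> real i\<^sub>0 + 1" "real i\<^sub>0 + g \<le> real i" "0 \<le> g"
  shows "(c' * g - C) * real k powr \<alpha> \<le> (\<Sum>l<i. p l) - (\<Sum>l<j. q l)"
proof -
  have "i\<^sub>0 \<le> i" using assms by linarith
  then have "(\<Sum>l<i. p l) = (\<Sum>l<i\<^sub>0. p l) + (\<Sum>l=i\<^sub>0..<i. p l)"
    by (simp add: sum.atLeastLessThan_concat lessThan_atLeast0)
  moreover have "(\<Sum>l<j. q l) \<le> (\<Sum>l<i\<^sub>0. q l)"
    using assms by (intro sum_mono2) (auto intro: q_nonneg)
  moreover have "c' * g * real k powr \<alpha> \<le> (\<Sum>l=i\<^sub>0..<i. p l)"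
    by (rule sum_p_block_ge) fact+
  moreover have "\<bar>(\<Sum>l<i\<^sub>0. p l) - (\<Sum>l<i\<^sub>0. q l)\<bar> \<le> C * real k powr \<alpha>"
    by (rule sum_diff) fact
  ultimately show ?thesis by (simp add: algebra_simps abs_le_iff)
qed

text \<open>
  The same for sums that start at \<open>i\<^sub>0\<close> and \<open>j\<^sub>0\<close>, both of order \<open>k\<close>. Matching the terms one by one, each of the
  at most \<open>n\<close> pairs costs \<open>O((m + 1) * k powr (\<alpha> - 1))\<close>, because the offset of the indices stays that of the
  starting points.
\<close>

lemma gap_in_window:
  assumes "k \<ge> 1" "n \<le> k"
    and "real k / 2 \<le> real i\<^sub>0" "real i\<^sub>0 \<le> 3 * real k / 2"
    and "real k / 2 \<le> real j\<^sub>0" "real j\<^sub>0 \<le> 3 * real k / 2"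
    and "\<bar>real i\<^sub>0 - real j\<^sub>0\<bar> \<le> m"
    and "j\<^sub>0 \<le> j" "j - j\<^sub>0 \<le> n" "real i - real i\<^sub>0 \<ge> real j - real j\<^sub>0 + g" "0 \<le> g"
  shows "(c' * g - C * (m + 1) * real n / real k) * real k powr \<alpha>
     \<le> (\<Sum>l=i\<^sub>0..<i. p l) - (\<Sum>l=j\<^sub>0..<j. q l)"
proof -
  define a where "a = j - j\<^sub>0"
  have a: "j = j\<^sub>0 + a" "a \<le> n" "i\<^sub>0 + a \<le> i"
    using assms by (auto simp: a_def)
  have "(\<Sum>l=i\<^sub>0..<i. p l) = (\<Sum>l=i\<^sub>0..<i\<^sub>0+a. p l) + (\<Sum>l=i\<^sub>0+a..<i. p l)"
    using a by (simp add: sum.atLeastLessThan_concat)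
  moreover have "(\<Sum>l=i\<^sub>0..<i\<^sub>0+a. p l) = (\<Sum>l<a. p (i\<^sub>0 + l))"
    using sum.shift_bounds_nat_ivl[of p 0 i\<^sub>0 a] by (simp add: lessThan_atLeast0 add.commute)
  moreover have "(\<Sum>l=j\<^sub>0..<j. q l) = (\<Sum>l<a. q (j\<^sub>0 + l))"
    using sum.shift_bounds_nat_ivl[of q 0 j\<^sub>0 a] a by (simp add: lessThan_atLeast0 add.commute)
  moreover have "c' * g * real k powr \<alpha> \<le> (\<Sum>l=i\<^sub>0+a..<i. p l)"
    using assms a by (intro sum_p_block_ge) auto
  moreover have "(\<Sum>l<a. q (j\<^sub>0 + l)) - (\<Sum>l<a. p (i\<^sub>0 + l)) \<le> C * (m + 1) * real n / real k * real k powr \<alpha>"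
  proof -
    have "(\<Sum>l<a. q (j\<^sub>0 + l)) - (\<Sum>l<a. p (i\<^sub>0 + l)) = (\<Sum>l<a. q (j\<^sub>0 + l) - p (i\<^sub>0 + l))"
      by (simp add: sum_subtractf)
    also have "\<dots> \<le> (\<Sum>l<a. C * real k powr (\<alpha> - 1) * (m + 1))"
    proof (rule sum_mono)
      fix l assume "l \<in> {..<a}"
      then have l: "real l + 1 \<le> real k"
        using a assms(2) by auto
      have "\<bar>p (i\<^sub>0 + l) - q (j\<^sub>0 + l)\<bar> \<le> C * real k powr (\<alpha> - 1) * (\<bar>real (i\<^sub>0 + l) - real (j\<^sub>0 + l)\<bar> + 1)"
        by (rule diff) (use l assms in auto)
      also have "\<dots> \<le> C * real k powr (\<alpha> - 1) * (m + 1)"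
        using assms C_pos by (intro mult_left_mono) auto
      finally show "q (j\<^sub>0 + l) - p (i\<^sub>0 + l) \<le> C * real k powr (\<alpha> - 1) * (m + 1)"
        by simp
    qed
    also have "\<dots> = real a * (C * real k powr (\<alpha> - 1) * (m + 1))"
      by simp
    also have "\<dots> \<le> real n * (C * real k powr (\<alpha> - 1) * (m + 1))"
      using a assms C_pos by (intro mult_right_mono) auto
    also have "\<dots> = C * (m + 1) * real n / real k * real k powr \<alpha>"
      using assms by (simp add: powr_diff)
    finally show ?thesis .
  qed
  ultimately show ?thesis by (simp add: algebra_simps)
qed

end

section \<open>Gaussian bounds for the discrepancy\<close>

locale comparable_urn = urn \<Omega> b r Bl Rd +
    comparable_weights \<alpha> c C "\<lambda>i. 1 / b i" "\<lambda>i. 1 / r i"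
  for \<Omega> :: "'a measure" and b r Bl Rd \<alpha> c C
begin

sublocale swap: comparable_weights \<alpha> c C "\<lambda>i. 1 / r i" "\<lambda>i. 1 / b i"
  by (rule comparable_weights_swap) unfold_locales

text \<open>
  Azuma's exponent for a gap \<open>c' * g / 2\<close>, steps at most \<open>C\<close> and \<open>3 * N\<close> steps is
  \<open>(c' * g / 2)\<^sup>2 / (2 * C\<^sup>2 * 3 * N) = rate * g\<^sup>2 / N\<close>.
\<close>

definition rate :: real where "rate = c'\<^sup>2 / (24 * C\<^sup>2)"

lemma rate_pos: "rate > 0"
  using c'_pos C_pos by (simp add: rate_def)

text \<open>
  As long as both counts stay below \<open>5 * k\<close>, the steps of the martingale are at most \<open>C * k powr \<alpha>\<close>. Taking gaps
  also in units of \<open>k powr \<alpha>\<close> makes this factor cancel from the exponent. The sign \<open>\<sigma>\<close> selects which colour is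
  in excess.
\<close>

lemma azuma_urn:
  assumes sign: "\<sigma> = 1 \<or> \<sigma> = - 1"
    and window: "\<And>i j. (i, j) \<in> D \<Longrightarrow> real i + 1 \<le> 5 * real k \<and> real j + 1 \<le> 5 * real k"
    and gap: "\<And>i j. (i, j) \<in> E \<Longrightarrow> c' * g / 2 * real k powr \<alpha> \<le> \<sigma> * (balance (i, j) - balance s)"
    and pos: "g > 0" "k \<ge> 1" "N \<ge> 1"
    and past: "\<And>x x'. (\<And>l. l \<le> n \<Longrightarrow> x l = x' l) \<Longrightarrow> Q x = Q x'"
    and start: "\<And>x. Q x \<Longrightarrow> x n = s"
  shows "prob {\<omega>\<in>space \<Omega>. Q (\<lambda>l. (Bl l \<omega>, Rd l \<omega>)) \<and>
             reaches D E (3 * N) (\<lambda>l. (Bl (n + l) \<omega>, Rd (n + l) \<omega>))}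
         \<le> prob {\<omega>\<in>space \<Omega>. Q (\<lambda>l. (Bl l \<omega>, Rd l \<omega>))} * exp (- (rate * g\<^sup>2 / real N))"
proof -
  let ?u = "real k powr \<alpha>"
  have u: "?u > 0" using pos by simp
  have exponent: "(c' * g / 2 * ?u)\<^sup>2 / (2 * (C * ?u)\<^sup>2 * real (3 * N)) = rate * g\<^sup>2 / real N"
    using u C_pos pos by (simp add: rate_def field_simps power2_eq_square)
  show ?thesis
    unfolding exponent[symmetric]
  proof (rule azuma_reach[where f = "\<lambda>s. \<sigma> * balance s" and s = s and Q = Q])
    fix u y assume u: "u \<in> D" and y: "y \<in> set_pmf (urn_kernel b r u)"
    obtain i j where ij: "u = (i, j)" by (cases u)
    have "\<bar>balance y - balance (i, j)\<bar> \<le> C * ?u"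
      using u y window[of i j] pos unfolding ij
      by (intro balance_step) (auto intro!: upper)
    then show "\<bar>\<sigma> * balance y - \<sigma> * balance u\<bar> \<le> C * ?u"
      using sign by (auto simp: ij)
  next
    fix u show "measure_pmf.expectation (urn_kernel b r u) (\<lambda>s. \<sigma> * balance s) = \<sigma> * balance u"
      by (simp add: balance_martingale)
  next
    fix y assume "y \<in> E"
    then show "c' * g / 2 * ?u \<le> \<sigma> * balance y - \<sigma> * balance s"
      using gap[of "fst y" "snd y"] by (simp add: right_diff_distrib)
  next
    show "Q x = Q x'" if "\<And>l. l \<le> n \<Longrightarrow> x l = x' l" for x x'
      using that by (rule past)
  next
    show "x n = s" if "Q x" for x
      using that by (rule start)
  qed (use pos c'_pos C_pos u in auto)
qed

lemma balance_diff:
  assumes "i\<^sub>0 \<le> i" "j\<^sub>0 \<le> j"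
  shows "balance (i, j) - balance (i\<^sub>0, j\<^sub>0) = (\<Sum>l=i\<^sub>0..<i. 1 / b l) - (\<Sum>l=j\<^sub>0..<j. 1 / r l)"
  using sum.atLeastLessThan_concat[of 0 i\<^sub>0 i "\<lambda>l. 1 / b l"]
    sum.atLeastLessThan_concat[of 0 j\<^sub>0 j "\<lambda>l. 1 / r l"] assms
  by (simp add: balance_def lessThan_atLeast0)

text \<open>
  Red reaches \<open>k + m\<close> before blue exceeds \<open>k\<close>, and blue reaches \<open>k\<close> while red is at most \<open>k - m\<close>. The times are
  written \<open>0 + l\<close> to match the general hitting event from time \<open>n\<close>.
\<close>

definition many_red :: "nat \<Rightarrow> real \<Rightarrow> 'a set" where
  "many_red k m = {\<omega>\<in>space \<Omega>. (Bl 0 \<omega>, Rd 0 \<omega>) = (0, 0) \<and>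
     reaches {(i, j). i < k \<and> real j < real k + m} {(i, j). i \<le> k \<and> real k + m \<le> real j}
       (3 * k) (\<lambda>l. (Bl (0 + l) \<omega>, Rd (0 + l) \<omega>))}"

definition few_red :: "nat \<Rightarrow> real \<Rightarrow> 'a set" where
  "few_red k m = {\<omega>\<in>space \<Omega>. (Bl 0 \<omega>, Rd 0 \<omega>) = (0, 0) \<and>
     reaches {(i, j). i < k \<and> real j \<le> real k - m} {(i, j). k \<le> i \<and> real j \<le> real k - m}
       (3 * k) (\<lambda>l. (Bl (0 + l) \<omega>, Rd (0 + l) \<omega>))}"

text \<open>
  The assumption \<open>2 * C \<le> c' * m\<close> lets the surplus of \<open>m\<close> terms dominate, with half of it to spare, the difference
  between the two partial sums up to \<open>k\<close>. The martingale has then moved by order \<open>m * k powr \<alpha>\<close> in at most \<open>3 * k\<close>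
  steps of size \<open>O(k powr \<alpha>)\<close>.
\<close>

lemma early_imbalance_rare:
  assumes k: "k \<ge> 1" and m: "m \<le> real k / 2" "2 * C \<le> c' * m"
  shows "prob (many_red k m) \<le> exp (- (rate * m\<^sup>2 / real k))"
    and "prob (few_red k m) \<le> exp (- (rate * m\<^sup>2 / real k))"
proof -
  have "0 < c' * m" using m(2) C_pos by linarith
  then have m_pos: "m > 0" using c'_pos by (simp add: zero_less_mult_iff)
  have half: "c' * m / 2 * real k powr \<alpha> \<le> (c' * m - C) * real k powr \<alpha>"
    using m by (intro mult_right_mono) (linarith, simp)
  have "prob (many_red k m) \<le> prob {\<omega>\<in>space \<Omega>. (Bl 0 \<omega>, Rd 0 \<omega>) = (0, 0)} * exp (- (rate * m\<^sup>2 / real k))"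
    unfolding many_red_def
  proof (rule azuma_urn[where \<sigma> = "-1" and k = k and s = "(0, 0)" and Q = "\<lambda>x. x 0 = (0, 0)"])
    fix i j assume "(i, j) \<in> {(i, j). i \<le> k \<and> real k + m \<le> real j}"
    then have "(c' * m - C) * real k powr \<alpha> \<le> (\<Sum>l<j. 1 / r l) - (\<Sum>l<i. 1 / b l)"
      using m_pos k by (intro swap.gap_from_origin[where i\<^sub>0 = k]) auto
    then show "c' * m / 2 * real k powr \<alpha> \<le> - 1 * (balance (i, j) - balance (0, 0))"
      using half by (simp add: balance_def)
  qed (use m m_pos k in auto)
  also have "\<dots> \<le> 1 * exp (- (rate * m\<^sup>2 / real k))"
    by (intro mult_right_mono) auto
  finally show "prob (many_red k m) \<le> exp (- (rate * m\<^sup>2 / real k))" by simp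
  have "prob (few_red k m) \<le> prob {\<omega>\<in>space \<Omega>. (Bl 0 \<omega>, Rd 0 \<omega>) = (0, 0)} * exp (- (rate * m\<^sup>2 / real k))"
    unfolding few_red_def
  proof (rule azuma_urn[where \<sigma> = 1 and k = k and s = "(0, 0)" and Q = "\<lambda>x. x 0 = (0, 0)"])
    fix i j assume ij: "(i, j) \<in> {(i, j). k \<le> i \<and> real j \<le> real k - m}"
    define i\<^sub>0 where "i\<^sub>0 = nat \<lfloor>real k - m\<rfloor>"
    have "real k - m \<ge> 0" using m k by linarith
    then have i\<^sub>0: "real i\<^sub>0 \<le> real k - m" "real k - m < real i\<^sub>0 + 1"
      unfolding i\<^sub>0_def by linarith+
    then have "real j < real i\<^sub>0 + 1" using ij by simp
    then have "j \<le> i\<^sub>0" by linarith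
    then have "(c' * m - C) * real k powr \<alpha> \<le> (\<Sum>l<i. 1 / b l) - (\<Sum>l<j. 1 / r l)"
      using m m_pos i\<^sub>0 ij by (intro gap_from_origin[where i\<^sub>0 = i\<^sub>0]) auto
    then show "c' * m / 2 * real k powr \<alpha> \<le> 1 * (balance (i, j) - balance (0, 0))"
      using half by (simp add: balance_def)
  qed (use m m_pos k in auto)
  also have "\<dots> \<le> 1 * exp (- (rate * m\<^sup>2 / real k))"
    by (intro mult_right_mono) auto
  finally show "prob (few_red k m) \<le> exp (- (rate * m\<^sup>2 / real k))" by simp
qed

text \<open>
  The \<open>k\<close>-th blue ball is drawn when there are \<open>j\<close> red ones, that is, at time \<open>k + j\<close>. In this form the event
  depends on the past of a deterministic time, and for distinct \<open>j\<close> the events are disjoint.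
\<close>

definition first_entry :: "nat \<Rightarrow> nat \<Rightarrow> (nat \<Rightarrow> nat \<times> nat) \<Rightarrow> bool" where
  "first_entry k j x \<longleftrightarrow> (\<forall>l<k + j. fst (x l) < k) \<and> x (k + j) = (k, j)"

definition entry_event :: "nat \<Rightarrow> nat \<Rightarrow> 'a set" where
  "entry_event k j = {\<omega>\<in>space \<Omega>. first_entry k j (\<lambda>l. (Bl l \<omega>, Rd l \<omega>))}"

definition block :: "nat \<Rightarrow> nat \<Rightarrow> nat \<Rightarrow> real \<Rightarrow> (nat \<times> nat) set" where
  "block k j n h = {(i', j'). k \<le> i' \<and> i' < k + n \<and> j \<le> j' \<and>
     \<bar>(real j' - real j) - (real i' - real k)\<bar> < h}"

definition red_excess :: "nat \<Rightarrow> nat \<Rightarrow> nat \<Rightarrow> real \<Rightarrow> (nat \<times> nat) set" where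
  "red_excess k j n h = {(i', j'). k \<le> i' \<and> i' \<le> k + n \<and> j \<le> j' \<and>
     h \<le> (real j' - real j) - (real i' - real k)}"

definition blue_excess :: "nat \<Rightarrow> nat \<Rightarrow> nat \<Rightarrow> real \<Rightarrow> (nat \<times> nat) set" where
  "blue_excess k j n h = {(i', j'). k \<le> i' \<and> i' \<le> k + n \<and> j \<le> j' \<and>
     h \<le> (real i' - real k) - (real j' - real j)}"

definition deviating :: "nat \<Rightarrow> nat \<Rightarrow> nat \<Rightarrow> real \<Rightarrow> 'a set" where
  "deviating k j n h = {\<omega>\<in>space \<Omega>. first_entry k j (\<lambda>l. (Bl l \<omega>, Rd l \<omega>)) \<and>
     reaches (block k j n h) (red_excess k j n h \<union> blue_excess k j n h) (3 * n)
       (\<lambda>l. (Bl (k + j + l) \<omega>, Rd (k + j + l) \<omega>))}"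

lemma first_entry_measurable [measurable]:
  "Measurable.pred \<Omega> (\<lambda>\<omega>. first_entry k j (\<lambda>l. (Bl l \<omega>, Rd l \<omega>)))"
  unfolding first_entry_def by measurable

lemma events_measurable [measurable]:
  "many_red k m \<in> sets \<Omega>" "few_red k m \<in> sets \<Omega>"
  "entry_event k j \<in> sets \<Omega>" "deviating k j n h \<in> sets \<Omega>"
  unfolding many_red_def few_red_def entry_event_def deviating_def by measurable

text \<open>
  A deviation by \<open>h\<close> during the next \<open>n\<close> blue draws moves the martingale by order \<open>h * k powr \<alpha>\<close> in at most \<open>3 * n\<close>
  steps: before the deviation there are fewer than \<open>n\<close> blue and fewer than \<open>n + h \<le> 2 * n\<close> red draws. The
  assumption on \<open>C * (m + 1) * n / k\<close> says that the drift caused by the initial imbalance uses at most half of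
  the gap.
\<close>

lemma deviation_after_entry_rare:
  assumes n: "1 \<le> n" "n \<le> k" and m: "\<bar>real j - real k\<bar> \<le> m" "m \<le> real k / 2"
    and h: "0 < h" "h \<le> real n" and err: "C * (m + 1) * real n / real k \<le> c' * h / 2"
  shows "prob (deviating k j n h) \<le> prob (entry_event k j) * (2 * exp (- (rate * h\<^sup>2 / real n)))"
proof -
  let ?P = "\<lambda>E. {\<omega>\<in>space \<Omega>. first_entry k j (\<lambda>l. (Bl l \<omega>, Rd l \<omega>)) \<and>
     reaches (block k j n h) E (3 * n) (\<lambda>l. (Bl (k + j + l) \<omega>, Rd (k + j + l) \<omega>))}"
  have k: "k \<ge> 1" and j: "real k / 2 \<le> real j" "real j \<le> 3 * real k / 2"
    using n m by auto
  have window: "real i' + 1 \<le> 5 * real k \<and> real j' + 1 \<le> 5 * real k"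
    if "(i', j') \<in> block k j n h" for i' j'
    using that n h j k unfolding block_def by auto
  have half: "c' * h / 2 * real k powr \<alpha> \<le> (c' * h - C * (m + 1) * real n / real k) * real k powr \<alpha>"
    using err by (intro mult_right_mono) (linarith, simp)
  have past: "first_entry k j x = first_entry k j x'" if "\<And>l. l \<le> k + j \<Longrightarrow> x l = x' l" for x x'
    using that by (auto simp: first_entry_def)
  have start: "x (k + j) = (k, j)" if "first_entry k j x" for x
    using that by (simp add: first_entry_def)
  have red: "prob (?P (red_excess k j n h)) \<le> prob (entry_event k j) * exp (- (rate * h\<^sup>2 / real n))"
    unfolding entry_event_def
  proof (rule azuma_urn[where \<sigma> = "-1" and k = k and s = "(k, j)", OF _ window _ h(1) k n(1) past start])
    fix i' j' assume ij: "(i', j') \<in> red_excess k j n h"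
    note half
    also have "(c' * h - C * (m + 1) * real n / real k) * real k powr \<alpha> \<le> (\<Sum>l=j..<j'. 1 / r l) - (\<Sum>l=k..<i'. 1 / b l)"
      using ij n m h j k by (intro swap.gap_in_window) (auto simp: red_excess_def)
    also have "\<dots> = - 1 * (balance (i', j') - balance (k, j))"
      using ij by (subst balance_diff) (auto simp: red_excess_def)
    finally show "c' * h / 2 * real k powr \<alpha> \<le> - 1 * (balance (i', j') - balance (k, j))" .
  qed auto
  have blue: "prob (?P (blue_excess k j n h)) \<le> prob (entry_event k j) * exp (- (rate * h\<^sup>2 / real n))"
    unfolding entry_event_def
  proof (rule azuma_urn[where \<sigma> = 1 and k = k and s = "(k, j)", OF _ window _ h(1) k n(1) past start])
    fix i' j' assume ij: "(i', j') \<in> blue_excess k j n h"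
    note half
    also have "(c' * h - C * (m + 1) * real n / real k) * real k powr \<alpha> \<le> (\<Sum>l=k..<i'. 1 / b l) - (\<Sum>l=j..<j'. 1 / r l)"
      using ij n m h j k by (intro gap_in_window) (auto simp: blue_excess_def)
    also have "\<dots> = 1 * (balance (i', j') - balance (k, j))"
      using ij by (subst balance_diff) (auto simp: blue_excess_def)
    finally show "c' * h / 2 * real k powr \<alpha> \<le> 1 * (balance (i', j') - balance (k, j))" .
  qed auto
  have "deviating k j n h = ?P (red_excess k j n h) \<union> ?P (blue_excess k j n h)"
    by (auto simp: deviating_def reaches_Un)
  then have "prob (deviating k j n h) \<le> prob (?P (red_excess k j n h)) + prob (?P (blue_excess k j n h))"
    by (simp only:) (rule measure_Un_le; measurable)
  with red blue show ?thesis by (simp add: algebra_simps)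
qed

text \<open>
  The deterministic part: on a legal path with a large deviation, the composition \<open>(k, j)\<close> at the \<open>k\<close>-th blue
  draw is either unbalanced by \<open>m\<close>, or \<open>j\<close> is near \<open>k\<close> and the path leaves the strip \<open>block k j n h\<close> through one
  of its two sides.
\<close>

lemma large_deviation_cases:
  assumes \<omega>: "\<omega> \<in> space \<Omega>" and legal: "legal \<omega>"
    and n: "1 \<le> n" "n \<le> k" and m: "0 < m" "m \<le> real k / 2" and h: "0 < h" "h \<le> real n"
    and dev: "max_deviation Bl Rd k (k + n) \<omega> \<ge> ereal h"
  shows "\<omega> \<in> many_red k m \<or> \<omega> \<in> few_red k m \<or>
    (\<exists>j. \<bar>real j - real k\<bar> \<le> m \<and> \<omega> \<in> deviating k j n h)"
proof -
  note time = Bl_plus_Rd[OF legal] and Bm = Bl_mono[OF legal] and Rm = Rd_mono[OF legal]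
  obtain t i where t: "t \<le> i" "Bl t \<omega> = k" "\<And>l. l < t \<Longrightarrow> Bl l \<omega> < k"
    and i: "\<And>l. l < i \<Longrightarrow> Bl l \<omega> < k + n"
      "h \<le> \<bar>real_of_int (discrepancy Bl Rd i \<omega> - discrepancy Bl Rd t \<omega>)\<bar>"
    using max_deviation_ge_imp[OF legal dev] by blast
  define j where "j = Rd t \<omega>"
  have tj: "t = k + j" using time[of t] t by (simp add: j_def)
  have start: "(Bl 0 \<omega>, Rd 0 \<omega>) = (0, 0)" using legal by (simp add: legal_def)
  consider "real k + m \<le> real j" | "real j \<le> real k - m" | "\<bar>real j - real k\<bar> \<le> m"
    by linarith
  then show ?thesis
  proof cases
    case 1
    have "reaches {(i, j). i < k \<and> real j < real k + m} {(i, j). i \<le> k \<and> real k + m \<le> real j}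
       (3 * k) (\<lambda>l. (Bl (0 + l) \<omega>, Rd (0 + l) \<omega>))"
    proof (rule reaches_first[where i = t])
      fix l assume "l < t" and l: "(Bl (0 + l) \<omega>, Rd (0 + l) \<omega>) \<notin> {(i, j). i \<le> k \<and> real k + m \<le> real j}"
      then have "Bl l \<omega> < k" "real (Rd l \<omega>) < real k + m"
        using t(3)[of l] by auto
      then show "(Bl (0 + l) \<omega>, Rd (0 + l) \<omega>) \<in> {(i, j). i < k \<and> real j < real k + m} \<and> l < 3 * k"
        using time[of l] m by auto
    qed (use t 1 in \<open>simp add: j_def\<close>)
    then show ?thesis using \<omega> start by (simp add: many_red_def)
  next
    case 2
    have "reaches {(i, j). i < k \<and> real j \<le> real k - m} {(i, j). k \<le> i \<and> real j \<le> real k - m}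
       (3 * k) (\<lambda>l. (Bl (0 + l) \<omega>, Rd (0 + l) \<omega>))"
    proof (rule reaches_first[where i = t])
      fix l assume "l < t"
      then have "Bl l \<omega> < k" "real (Rd l \<omega>) \<le> real k - m"
        using t(3)[of l] Rm[of l t] 2 by (auto simp: j_def)
      then show "(Bl (0 + l) \<omega>, Rd (0 + l) \<omega>) \<in> {(i, j). i < k \<and> real j \<le> real k - m} \<and> l < 3 * k"
        using time[of l] m by auto
    qed (use t 2 in \<open>simp add: j_def\<close>)
    then show ?thesis using \<omega> start by (simp add: few_red_def)
  next
    case 3
    have D: "real_of_int (discrepancy Bl Rd i \<omega> - discrepancy Bl Rd t \<omega>)
        = (real (Rd i \<omega>) - real j) - (real (Bl i \<omega>) - real k)"
      using t by (simp add: discrepancy_def j_def)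
    have "reaches (block k j n h) (red_excess k j n h \<union> blue_excess k j n h) (3 * n)
       (\<lambda>l. (Bl (k + j + l) \<omega>, Rd (k + j + l) \<omega>))"
    proof (rule reaches_first[where i = "i - t"])
      have "Bl i \<omega> \<le> k + n"
      proof (cases "i = 0")
        case True
        then show ?thesis using legal by (simp add: legal_def)
      next
        case False
        then show ?thesis using i(1)[of "i - 1"] Bl_Suc_le(2)[OF legal, of "i - 1"] by simp
      qed
      moreover have "k \<le> Bl i \<omega>" "j \<le> Rd i \<omega>"
        using t Bm[of t i] Rm[of t i] by (auto simp: j_def)
      moreover have "k + j + (i - t) = i"
        using t tj by simp
      ultimately show "(Bl (k + j + (i - t)) \<omega>, Rd (k + j + (i - t)) \<omega>) \<in> red_excess k j n h \<union> blue_excess k j n h"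
        using i(2) unfolding D by (simp add: red_excess_def blue_excess_def) linarith
    next
      fix l assume l: "l < i - t"
        and out: "(Bl (k + j + l) \<omega>, Rd (k + j + l) \<omega>) \<notin> red_excess k j n h \<union> blue_excess k j n h"
      have B: "k \<le> Bl (t + l) \<omega>" "Bl (t + l) \<omega> < k + n" and R: "j \<le> Rd (t + l) \<omega>"
        using Bm[of t "t + l"] Rm[of t "t + l"] t(2) i(1)[of "t + l"] l by (auto simp: j_def)
      have dev: "\<bar>(real (Rd (t + l) \<omega>) - real j) - (real (Bl (t + l) \<omega>) - real k)\<bar> < h"
        using out B R unfolding tj[symmetric] red_excess_def blue_excess_def by auto
      have "real l = (real (Bl (t + l) \<omega>) - real k) + (real (Rd (t + l) \<omega>) - real j)"
        using time[of "t + l"] tj by linarith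
      moreover have "real (Bl (t + l) \<omega>) - real k < real n"
        using B by linarith
      ultimately have "real l < real (3 * n)"
        using dev h(2) by (simp add: abs_less_iff)
      then have "l < 3 * n" by (simp only: of_nat_less_iff)
      with B R dev show "(Bl (k + j + l) \<omega>, Rd (k + j + l) \<omega>) \<in> block k j n h \<and> l < 3 * n"
        unfolding tj[symmetric] by (simp add: block_def)
    qed
    moreover have "first_entry k j (\<lambda>l. (Bl l \<omega>, Rd l \<omega>))"
      using t by (simp add: first_entry_def tj[symmetric]) (simp add: j_def)
    ultimately show ?thesis using \<omega> 3 by (auto simp: deviating_def)
  qed
qed

text \<open>
  The bounds after entry carry the factor \<open>prob (entry_event k j)\<close>, and these probabilities sum to at most
  one over \<open>j\<close>; so the union over \<open>j\<close> costs nothing.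
\<close>

lemma max_deviation_tail:
  assumes n: "1 \<le> n" "n \<le> k" and m: "m \<le> real k / 2" "2 * C \<le> c' * m"
    and h: "0 < h" "h \<le> real n" and err: "C * (m + 1) * real n / real k \<le> c' * h / 2"
  shows "\<P>(\<omega> in \<Omega>. max_deviation Bl Rd k (k + n) \<omega> \<ge> ereal h)
    \<le> 2 * exp (- (rate * m\<^sup>2 / real k)) + 2 * exp (- (rate * h\<^sup>2 / real n))"
proof -
  define J where "J = {j. \<bar>real j - real k\<bar> \<le> m}"
  let ?e = "2 * exp (- (rate * h\<^sup>2 / real n))"
  have "0 < c' * m" using m(2) C_pos by linarith
  then have m_pos: "m > 0" using c'_pos by (simp add: zero_less_mult_iff)
  have "J \<subseteq> {..2 * k}" using m by (auto simp: J_def)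
  then have J: "finite J" by (rule finite_subset) simp
  have "\<P>(\<omega> in \<Omega>. max_deviation Bl Rd k (k + n) \<omega> \<ge> ereal h)
      \<le> prob ((many_red k m \<union> few_red k m) \<union> (\<Union>j\<in>J. deviating k j n h))"
  proof (rule finite_measure_mono_AE)
    show "AE \<omega> in \<Omega>. \<omega> \<in> {\<omega> \<in> space \<Omega>. ereal h \<le> max_deviation Bl Rd k (k + n) \<omega>} \<longrightarrow>
        \<omega> \<in> (many_red k m \<union> few_red k m) \<union> (\<Union>j\<in>J. deviating k j n h)"
      using AE_legal
    proof eventually_elim
      case (elim \<omega>)
      then show ?case
        using large_deviation_cases[OF _ elim n m_pos m(1) h] by (auto simp: J_def)
    qed
  qed (use J in measurable)
  also have "\<dots> \<le> prob (many_red k m \<union> few_red k m) + prob (\<Union>j\<in>J. deviating k j n h)"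
    using J by (intro measure_Un_le) measurable
  also have "prob (many_red k m \<union> few_red k m) \<le> prob (many_red k m) + prob (few_red k m)"
    by (intro measure_Un_le) measurable
  also have "prob (many_red k m) + prob (few_red k m) \<le> 2 * exp (- (rate * m\<^sup>2 / real k))"
    using early_imbalance_rare[of k m] n m by simp
  also have "prob (\<Union>j\<in>J. deviating k j n h) \<le> (\<Sum>j\<in>J. prob (deviating k j n h))"
    using J by (intro measure_UNION_le) auto
  also have "\<dots> \<le> (\<Sum>j\<in>J. prob (entry_event k j) * ?e)"
    using n m h err by (intro sum_mono deviation_after_entry_rare[where m = m]) (auto simp: J_def)
  also have "\<dots> = (\<Sum>j\<in>J. prob (entry_event k j)) * ?e"
    by (simp add: sum_distrib_right)
  also have "(\<Sum>j\<in>J. prob (entry_event k j)) = prob (\<Union>j\<in>J. entry_event k j)"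
  proof (rule finite_measure_finite_Union[symmetric, OF J])
    have "entry_event k j \<inter> entry_event k j' = {}" if "j < j'" for j j'
    proof (rule equals0I)
      fix \<omega> assume "\<omega> \<in> entry_event k j \<inter> entry_event k j'"
      then have "Bl (k + j) \<omega> = k" "\<forall>l<k + j'. Bl l \<omega> < k"
        by (auto simp: entry_event_def first_entry_def)
      moreover have "k + j < k + j'" using that by simp
      ultimately show False by (metis less_irrefl)
    qed
    then show "disjoint_family_on (entry_event k) J"
      unfolding disjoint_family_on_def by (metis Int_commute nat_neq_iff)
  qed auto
  also have "prob (\<Union>j\<in>J. entry_event k j) * ?e \<le> 1 * ?e"
    by (intro mult_right_mono) auto
  finally show ?thesis by simp
qed

end

lemma blue_red_near_power:
  fixes \<alpha> B :: real and w :: "nat \<Rightarrow> real" and t :: urn_type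
  assumes "\<alpha> > 0" and "\<And>n. w n > 0"
    and "\<exists>\<epsilon> \<in> O(\<lambda>n. 1 / real n ^ 2). \<forall>\<^sub>F n in sequentially.
           1 / w n = real n powr \<alpha> * (1 + 2 * B / real n + \<epsilon> n)"
  obtains c C where "comparable_weights \<alpha> c C (\<lambda>i. 1 / blue_weight t w i) (\<lambda>i. 1 / red_weight t w i)"
proof -
  obtain C where C: "C > 0" "\<And>n. \<bar>1 / w n - (real n + 1) powr \<alpha>\<bar> \<le> C * (real n + 1) powr (\<alpha> - 1)"
    using assms(3) inverse_weight_expansion by blast
  obtain C' where C': "C' > 0" "near_power \<alpha> (2 powr \<alpha>) C' (\<lambda>i. 1 / w (2 * i))"
    "near_power \<alpha> (2 powr \<alpha>) C' (\<lambda>i. 1 / w (2 * i + 1))"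
    using near_power_subsequences[OF assms(1,2) C] by blast
  have "near_power \<alpha> (2 powr \<alpha>) C' (\<lambda>i. 1 / blue_weight t w i)"
    "near_power \<alpha> (2 powr \<alpha>) C' (\<lambda>i. 1 / red_weight t w i)"
    using C' by (cases t; simp)+
  then show thesis
    using near_power_comparable[of \<alpha> "2 powr \<alpha>" C'] C'(1) assms(1) that by auto
qed

theorem lemma3p5:
  fixes \<alpha> B :: real and w :: "nat \<Rightarrow> real" and t :: urn_type
    and \<Omega> :: "'a measure" and Bl Rd :: "nat \<Rightarrow> 'a \<Rightarrow> nat"
  assumes "\<alpha> > 0"
    and "\<And>n. w n > 0"
    and "\<exists>\<epsilon> \<in> O(\<lambda>n. 1 / real n ^ 2). \<forall>\<^sub>F n in sequentially.
           1 / w n = real n powr \<alpha> * (1 + 2 * B / real n + \<epsilon> n)"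
    and "polya_urn \<Omega> (blue_weight t w) (red_weight t w) Bl Rd"
  shows "\<exists>M0 c4 :: real. M0 > 0 \<and> c4 > 0 \<and>
    (\<forall>(M::nat) (n::nat) (y::real). real M \<ge> M0 \<longrightarrow> n \<ge> 1 \<longrightarrow> 0 \<le> y \<longrightarrow> y \<le> sqrt (real n) \<longrightarrow>
      \<P>(\<omega> in \<Omega>. max_deviation Bl Rd (M * n) ((M + 1) * n) \<omega> \<ge> ereal (y * sqrt (real n)))
        \<le> 1 / c4 * exp (- c4 * y\<^sup>2))"
proof -
  obtain c C where weights:
    "comparable_weights \<alpha> c C (\<lambda>i. 1 / blue_weight t w i) (\<lambda>i. 1 / red_weight t w i)"
    using blue_red_near_power[OF assms(1-3)] by blast
  have "blue_weight t w i > 0" "red_weight t w i > 0" for i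
    using assms(2) by (cases t; simp)+
  then interpret comparable_urn \<Omega> "blue_weight t w" "red_weight t w" Bl Rd \<alpha> c C
    using weights assms(4)
    by (auto simp: comparable_urn_def urn_def urn_axioms_def polya_urn_def markov_chain_def)
  \<comment> \<open>The imbalance tolerated at the start is \<open>m = \<delta> * M * h\<close>. It gives \<open>C * m * n / k = C * \<delta> * h\<close>, so \<open>\<delta> \<le> c' / (4 * C)\<close> keeps the drift below a quarter of the available gap \<open>c' * h\<close>; and \<open>m\<^sup>2 / k = \<delta>\<^sup>2 * y\<^sup>2 * M\<close>, so the cost of a larger imbalance is Gaussian in \<open>y\<close> uniformly in \<open>M\<close>.\<close>
  define \<delta> where "\<delta> = min (1 / 2) (c' / (4 * C))"
  \<comment> \<open>Below \<open>y\<^sub>0\<close> the claimed bound exceeds one; above it the additive errors of order \<open>C\<close> are negligible.\<close>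
  define y\<^sub>0 where "y\<^sub>0 = 4 * C / (c' * \<delta>)"
  \<comment> \<open>The three bounds on \<open>c\<^sub>4\<close> pay for the factor \<open>4\<close> from the union of the exceptional events, for the rate of the first stage, which is the smaller one, and for the range \<open>y < y\<^sub>0\<close>.\<close>
  define c\<^sub>4 where "c\<^sub>4 = min (1 / 4) (min (rate * \<delta>\<^sup>2) (1 / y\<^sub>0\<^sup>2))"
  have \<delta>: "\<delta> > 0" "\<delta> \<le> 1 / 2" "C * \<delta> \<le> c' / 4"
    using c'_pos C_pos by (auto simp: \<delta>_def min_def field_simps)
  have y\<^sub>0: "y\<^sub>0 > 0"
    using \<delta> c'_pos C_pos by (simp add: y\<^sub>0_def)
  have c\<^sub>4: "c\<^sub>4 > 0" "c\<^sub>4 \<le> 1 / 4" "c\<^sub>4 \<le> rate * \<delta>\<^sup>2" "c\<^sub>4 \<le> 1 / y\<^sub>0\<^sup>2"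
    using \<delta> y\<^sub>0 rate_pos by (auto simp: c\<^sub>4_def)
  have inv: "4 \<le> 1 / c\<^sub>4" using c\<^sub>4 by (simp add: field_simps)
  have "\<P>(\<omega> in \<Omega>. max_deviation Bl Rd (M * n) ((M + 1) * n) \<omega> \<ge> ereal (y * sqrt (real n)))
      \<le> 1 / c\<^sub>4 * exp (- c\<^sub>4 * y\<^sup>2)"
    if M: "real M \<ge> 1" and n: "n \<ge> 1" and y: "0 \<le> y" "y \<le> sqrt (real n)" for M n :: nat and y :: real
  proof (cases "y < y\<^sub>0")
    case True
    have "c\<^sub>4 * y\<^sup>2 \<le> 1 / y\<^sub>0\<^sup>2 * y\<^sub>0\<^sup>2"
      using True y c\<^sub>4 by (intro mult_mono power_mono) auto
    then have "exp (- 1) \<le> exp (- c\<^sub>4 * y\<^sup>2)" using y\<^sub>0 by simp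
    moreover have "1 / 4 \<le> exp (- 1 :: real)"
      using exp_le by (simp add: exp_minus field_simps)
    ultimately have "1 / 4 \<le> exp (- c\<^sub>4 * y\<^sup>2)" by linarith
    then have "4 * (1 / 4) \<le> 1 / c\<^sub>4 * exp (- c\<^sub>4 * y\<^sup>2)"
      using inv c\<^sub>4(1) by (intro mult_mono) auto
    then show ?thesis by (simp add: order_trans[OF prob_le_1])
  next
    case False
    define k where "k = M * n"
    define h where "h = y * sqrt (real n)"
    define m where "m = \<delta> * real M * h"
    have k: "n \<le> k" "1 \<le> k" "real k = real M * real n"
      using M n by (auto simp: k_def)
    have sq: "sqrt (real n) * sqrt (real n) = real n" "1 \<le> sqrt (real n)"
      using n by auto
    have "y * 1 \<le> h" unfolding h_def using y sq by (intro mult_left_mono) auto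
    then have h_ge: "y\<^sub>0 \<le> h" using False by simp
    have h_pos: "0 < h" using h_ge y\<^sub>0 by linarith
    have "h \<le> sqrt (real n) * sqrt (real n)"
      unfolding h_def using y by (intro mult_right_mono) auto
    then have h_le: "h \<le> real n" using sq by simp
    have "\<delta> * real M * h \<le> 1 / 2 * real M * real n"
      using \<delta> M h_pos h_le by (intro mult_mono) auto
    then have m_le: "m \<le> real k / 2" by (simp add: m_def k)
    have "c' * \<delta> * y\<^sub>0 = 4 * C" using c'_pos \<delta> by (simp add: y\<^sub>0_def)
    moreover have "c' * \<delta> * y\<^sub>0 \<le> c' * \<delta> * h"
      using h_ge c'_pos \<delta> by (intro mult_left_mono) auto
    moreover have "c' * \<delta> * h * 1 \<le> c' * \<delta> * h * real M"
      using M h_pos c'_pos \<delta> by (intro mult_left_mono) auto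
    ultimately have m_ge: "2 * C \<le> c' * m"
      using C_pos by (simp add: m_def mult_ac)
    have err: "C * (m + 1) * real n / real k \<le> c' * h / 2"
    proof -
      have "C * (m + 1) * real n / real k = C * \<delta> * h + C / real M"
        using M n by (simp add: m_def k field_simps)
      moreover have "C * \<delta> * h \<le> c' / 4 * h"
        using \<delta> h_pos by (intro mult_right_mono) auto
      moreover have "C / real M \<le> C / 1"
        using M C_pos by (intro divide_left_mono) auto
      moreover have "C \<le> c' / 4 * h"
      proof -
        have "4 * C = c' * \<delta> * y\<^sub>0" using c'_pos \<delta> by (simp add: y\<^sub>0_def)
        also have "\<dots> \<le> c' * 1 * h"
          using \<delta> c'_pos h_ge y\<^sub>0 by (intro mult_mono) auto
        finally show ?thesis by simp
      qed
      ultimately show ?thesis by simp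
    qed
    have "\<P>(\<omega> in \<Omega>. max_deviation Bl Rd k (k + n) \<omega> \<ge> ereal h)
        \<le> 2 * exp (- (rate * m\<^sup>2 / real k)) + 2 * exp (- (rate * h\<^sup>2 / real n))"
      by (rule max_deviation_tail) fact+
    also have "\<dots> \<le> 2 * exp (- c\<^sub>4 * y\<^sup>2) + 2 * exp (- c\<^sub>4 * y\<^sup>2)"
    proof -
      have hh: "h\<^sup>2 = y\<^sup>2 * real n" by (simp add: h_def power_mult_distrib)
      have "rate * m\<^sup>2 / real k = rate * \<delta>\<^sup>2 * y\<^sup>2 * real M"
        using M n by (simp add: m_def k power_mult_distrib hh) (simp add: power2_eq_square)
      moreover have "rate * \<delta>\<^sup>2 * y\<^sup>2 * 1 \<le> rate * \<delta>\<^sup>2 * y\<^sup>2 * real M"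
        using M rate_pos by (intro mult_left_mono) auto
      moreover have "c\<^sub>4 * y\<^sup>2 \<le> rate * \<delta>\<^sup>2 * y\<^sup>2"
        using c\<^sub>4 by (intro mult_right_mono) auto
      ultimately have "c\<^sub>4 * y\<^sup>2 \<le> rate * m\<^sup>2 / real k" by linarith
      moreover have "\<delta>\<^sup>2 \<le> 1" using \<delta> by (intro power_le_one) auto
      then have "rate * \<delta>\<^sup>2 \<le> rate * 1" using rate_pos by (intro mult_left_mono) auto
      then have "c\<^sub>4 * y\<^sup>2 \<le> rate * y\<^sup>2" using c\<^sub>4 by (intro mult_right_mono) auto
      then have "c\<^sub>4 * y\<^sup>2 \<le> rate * h\<^sup>2 / real n" using n by (simp add: hh)
      ultimately show ?thesis by (intro add_mono) auto
    qed
    also have "\<dots> = 4 * exp (- c\<^sub>4 * y\<^sup>2)" by simp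
    also have "\<dots> \<le> 1 / c\<^sub>4 * exp (- c\<^sub>4 * y\<^sup>2)"
      using inv by (intro mult_right_mono) auto
    finally show ?thesis by (simp add: k_def h_def algebra_simps)
  qed
  with c\<^sub>4(1) show ?thesis
    by (intro exI[of _ 1] exI[of _ c\<^sub>4]) auto
qed

end
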